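(* Let $\Gamma\curvearrowright^{\alpha}(Y,\nu)$ be a strongly ergodic p.m.p. action of a countable group $\Gamma$, and let $K$ be a compact metrizable group. Then the cohomology equivalence relation on $Z^1(\alpha,K)$ is closed, i.e. it is a closed subset of $Z^1(\alpha,K)\times Z^1(\alpha,K)$. In particular, every cohomology class in $Z^1(\alpha,K)$ is closed.
   Context: $(Y,\nu)$ is a standard probability space; "p.m.p." means probability measure preserving. The action is strongly ergodic if every sequence of measurable sets $A_n\subseteq Y$ with $\nu(\gamma A_n\triangle A_n)\to0$ for all $\gamma\in\Gamma$ satisfies $\nu(A_n)(1-\nu(A_n))\to0$. $Z^1(\alpha,K)$ is the space of measurable cocycles of $\alpha$ with values in $K$: measurable maps $w:\Gamma\times Y\to K$ with $w(\gamma\delta,y)=w(\gamma,\delta y)w(\delta,y)$ for all $\gamma,\delta\in\Gamma$ and a.e. $y\in Y$, where maps agreeing almost everywhere are identified. It carries its natural Polish topology: fixing a compatible metric $d$ on $K$, $w_n\to w$ if and only if $\int_Y d(w_n(\gamma,y),w(\gamma,y))\,d\nu(y)\to0$ for every $\gamma\in\Gamma$. Two cocycles $u,v\in Z^1(\alpha,K)$ are cohomologous if there is a measurable map $\theta:Y\to K$ with $u(\gamma,y)=\theta(\gamma y)v(\gamma,y)\theta(y)^{-1}$ for all $\gamma\in\Gamma$ and a.e. $y\in Y$; this is the cohomology equivalence relation. *)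

theory Defs
  imports "HOL-Probability.Probability" "HOL-Algebra.Group_Action"
begin

definition borel_sigma :: "'a topology \<Rightarrow> 'a measure" where
  "borel_sigma X = sigma (topspace X) {U. openin X U}"

text \<open>A standard Borel space (the Borel space of some Polish topology) with a probability
  measure on the Borel sets; atoms are allowed, and the measure is not completed.\<close>

definition standard_probability_space :: "'y measure \<Rightarrow> bool" where
  "standard_probability_space \<nu> \<longleftrightarrow> prob_space \<nu> \<and>
     (\<exists>X. completely_metrizable_space X \<and> second_countable X \<and>
          topspace X = space \<nu> \<and> sets \<nu> = sets (borel_sigma X))"

definition pmp_action :: "('g, 'm) monoid_scheme \<Rightarrow> 'y measure \<Rightarrow> ('g \<Rightarrow> 'y \<Rightarrow> 'y) \<Rightarrow> bool" where
  "pmp_action \<Gamma> \<nu> \<alpha> \<longleftrightarrow> group_action \<Gamma> (space \<nu>) \<alpha> \<and>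
     (\<forall>\<gamma>\<in>carrier \<Gamma>. \<alpha> \<gamma> \<in> measurable \<nu> \<nu> \<and> distr \<nu> \<nu> (\<alpha> \<gamma>) = \<nu>)"

definition strongly_ergodic :: "('g, 'm) monoid_scheme \<Rightarrow> 'y measure \<Rightarrow> ('g \<Rightarrow> 'y \<Rightarrow> 'y) \<Rightarrow> bool" where
  "strongly_ergodic \<Gamma> \<nu> \<alpha> \<longleftrightarrow>
     (\<forall>A :: nat \<Rightarrow> 'y set. (\<forall>n. A n \<in> sets \<nu>) \<longrightarrow>
        (\<forall>\<gamma>\<in>carrier \<Gamma>. (\<lambda>n. measure \<nu> (sym_diff (\<alpha> \<gamma> ` A n) (A n))) \<longlonglongrightarrow> 0) \<longrightarrow>
        (\<lambda>n. measure \<nu> (A n) * (1 - measure \<nu> (A n))) \<longlonglongrightarrow> 0)"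

definition topological_group :: "('k, 'n) monoid_scheme \<Rightarrow> 'k topology \<Rightarrow> bool" where
  "topological_group K X \<longleftrightarrow> group K \<and> topspace X = carrier K \<and>
     continuous_map (prod_topology X X) X (\<lambda>(x, y). x \<otimes>\<^bsub>K\<^esub> y) \<and>
     continuous_map X X (\<lambda>x. inv\<^bsub>K\<^esub> x)"

definition compatible_metric :: "'k topology \<Rightarrow> ('k \<Rightarrow> 'k \<Rightarrow> real) \<Rightarrow> bool" where
  "compatible_metric X d \<longleftrightarrow>
     Metric_space (topspace X) d \<and> Metric_space.mtopology (topspace X) d = X"

text \<open>Cocycles as genuine functions, before identification almost everywhere.\<close>

definition cocycles :: "('g, 'm) monoid_scheme \<Rightarrow> 'y measure \<Rightarrow> ('g \<Rightarrow> 'y \<Rightarrow> 'y) \<Rightarrow>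
    ('k, 'n) monoid_scheme \<Rightarrow> 'k topology \<Rightarrow> ('g \<times> 'y \<Rightarrow> 'k) set" where
  "cocycles \<Gamma> \<nu> \<alpha> K X =
     {w. w \<in> measurable (count_space (carrier \<Gamma>) \<Otimes>\<^sub>M \<nu>) (borel_sigma X) \<and>
         (\<forall>\<gamma>\<in>carrier \<Gamma>. \<forall>\<delta>\<in>carrier \<Gamma>. AE y in \<nu>.
            w (\<gamma> \<otimes>\<^bsub>\<Gamma>\<^esub> \<delta>, y) = w (\<gamma>, \<alpha> \<delta> y) \<otimes>\<^bsub>K\<^esub> w (\<delta>, y))}"

definition ae_equal :: "('g, 'm) monoid_scheme \<Rightarrow> 'y measure \<Rightarrow> ('g \<Rightarrow> 'y \<Rightarrow> 'y) \<Rightarrow>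
    ('k, 'n) monoid_scheme \<Rightarrow> 'k topology \<Rightarrow> (('g \<times> 'y \<Rightarrow> 'k) \<times> ('g \<times> 'y \<Rightarrow> 'k)) set" where
  "ae_equal \<Gamma> \<nu> \<alpha> K X =
     {(u, v). u \<in> cocycles \<Gamma> \<nu> \<alpha> K X \<and> v \<in> cocycles \<Gamma> \<nu> \<alpha> K X \<and>
              (\<forall>\<gamma>\<in>carrier \<Gamma>. AE y in \<nu>. u (\<gamma>, y) = v (\<gamma>, y))}"

definition Z1 :: "('g, 'm) monoid_scheme \<Rightarrow> 'y measure \<Rightarrow> ('g \<Rightarrow> 'y \<Rightarrow> 'y) \<Rightarrow>
    ('k, 'n) monoid_scheme \<Rightarrow> 'k topology \<Rightarrow> ('g \<times> 'y \<Rightarrow> 'k) set set" where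
  "Z1 \<Gamma> \<nu> \<alpha> K X = cocycles \<Gamma> \<nu> \<alpha> K X // ae_equal \<Gamma> \<nu> \<alpha> K X"

definition cocycle_dist :: "'y measure \<Rightarrow> ('k \<Rightarrow> 'k \<Rightarrow> real) \<Rightarrow> 'g \<Rightarrow>
    ('g \<times> 'y \<Rightarrow> 'k) \<Rightarrow> ('g \<times> 'y \<Rightarrow> 'k) \<Rightarrow> real" where
  "cocycle_dist \<nu> d \<gamma> u v = (\<integral>y. d (u (\<gamma>, y)) (v (\<gamma>, y)) \<partial>\<nu>)"

text \<open>The topology of the pseudometrics \<open>cocycle_dist \<nu> d \<gamma>\<close>, one for each \<open>\<gamma>\<close>: the balls of
  these pseudometrics form a subbasis. That it has the intended convergent sequences is the lemma
  \<open>limitin_cocycle_topology\<close> below.\<close>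

definition cocycle_topology :: "('g, 'm) monoid_scheme \<Rightarrow> 'y measure \<Rightarrow> ('g \<Rightarrow> 'y \<Rightarrow> 'y) \<Rightarrow>
    ('k, 'n) monoid_scheme \<Rightarrow> 'k topology \<Rightarrow> ('k \<Rightarrow> 'k \<Rightarrow> real) \<Rightarrow>
    ('g \<times> 'y \<Rightarrow> 'k) set topology" where
  "cocycle_topology \<Gamma> \<nu> \<alpha> K X d = topology_generated_by
     {{V \<in> Z1 \<Gamma> \<nu> \<alpha> K X. \<exists>v\<in>V. cocycle_dist \<nu> d \<gamma> u v < \<epsilon>} | u \<gamma> \<epsilon>.
        u \<in> cocycles \<Gamma> \<nu> \<alpha> K X \<and> \<gamma> \<in> carrier \<Gamma> \<and> \<epsilon> > 0}"

definition cohomologous :: "('g, 'm) monoid_scheme \<Rightarrow> 'y measure \<Rightarrow> ('g \<Rightarrow> 'y \<Rightarrow> 'y) \<Rightarrow>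
    ('k, 'n) monoid_scheme \<Rightarrow> 'k topology \<Rightarrow> ('g \<times> 'y \<Rightarrow> 'k) \<Rightarrow> ('g \<times> 'y \<Rightarrow> 'k) \<Rightarrow> bool" where
  "cohomologous \<Gamma> \<nu> \<alpha> K X u v \<longleftrightarrow>
     (\<exists>\<theta> \<in> measurable \<nu> (borel_sigma X). \<forall>\<gamma>\<in>carrier \<Gamma>. AE y in \<nu>.
        u (\<gamma>, y) = \<theta> (\<alpha> \<gamma> y) \<otimes>\<^bsub>K\<^esub> v (\<gamma>, y) \<otimes>\<^bsub>K\<^esub> inv\<^bsub>K\<^esub> (\<theta> y))"

definition cohomology_rel :: "('g, 'm) monoid_scheme \<Rightarrow> 'y measure \<Rightarrow> ('g \<Rightarrow> 'y \<Rightarrow> 'y) \<Rightarrow>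
    ('k, 'n) monoid_scheme \<Rightarrow> 'k topology \<Rightarrow>
    (('g \<times> 'y \<Rightarrow> 'k) set \<times> ('g \<times> 'y \<Rightarrow> 'k) set) set" where
  "cohomology_rel \<Gamma> \<nu> \<alpha> K X =
     {(U, V). U \<in> Z1 \<Gamma> \<nu> \<alpha> K X \<and> V \<in> Z1 \<Gamma> \<nu> \<alpha> K X \<and>
              (\<exists>u\<in>U. \<exists>v\<in>V. cohomologous \<Gamma> \<nu> \<alpha> K X u v)}"

lemma equiv_ae_equal: "equiv (cocycles \<Gamma> \<nu> \<alpha> K X) (ae_equal \<Gamma> \<nu> \<alpha> K X)"
proof (rule equivI)
  show "ae_equal \<Gamma> \<nu> \<alpha> K X \<subseteq> cocycles \<Gamma> \<nu> \<alpha> K X \<times> cocycles \<Gamma> \<nu> \<alpha> K X"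
    by (auto simp: ae_equal_def)
  show "refl_on (cocycles \<Gamma> \<nu> \<alpha> K X) (ae_equal \<Gamma> \<nu> \<alpha> K X)"
    by (auto simp: refl_on_def ae_equal_def)
  show "sym (ae_equal \<Gamma> \<nu> \<alpha> K X)"
    by (auto simp: sym_def ae_equal_def eq_commute)
  show "trans (ae_equal \<Gamma> \<nu> \<alpha> K X)"
    unfolding trans_def
  proof (intro allI impI)
    fix u v w assume uv: "(u, v) \<in> ae_equal \<Gamma> \<nu> \<alpha> K X" and vw: "(v, w) \<in> ae_equal \<Gamma> \<nu> \<alpha> K X"
    have "AE y in \<nu>. u (\<gamma>, y) = w (\<gamma>, y)" if g: "\<gamma> \<in> carrier \<Gamma>" for \<gamma>
    proof -
      have "AE y in \<nu>. u (\<gamma>, y) = v (\<gamma>, y)" "AE y in \<nu>. v (\<gamma>, y) = w (\<gamma>, y)"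
        using uv vw g by (auto simp: ae_equal_def)
      then show ?thesis by eventually_elim simp
    qed
    with uv vw show "(u, w) \<in> ae_equal \<Gamma> \<nu> \<alpha> K X" by (auto simp: ae_equal_def)
  qed
qed

lemma topspace_cocycle_topology:
  fixes \<Gamma> :: "('g, 'm) monoid_scheme"
  assumes "group \<Gamma>"
  shows "topspace (cocycle_topology \<Gamma> \<nu> \<alpha> K X d) = Z1 \<Gamma> \<nu> \<alpha> K X"
proof
  show "topspace (cocycle_topology \<Gamma> \<nu> \<alpha> K X d) \<subseteq> Z1 \<Gamma> \<nu> \<alpha> K X"
    unfolding cocycle_topology_def topology_generated_by_topspace by auto
  show "Z1 \<Gamma> \<nu> \<alpha> K X \<subseteq> topspace (cocycle_topology \<Gamma> \<nu> \<alpha> K X d)"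
  proof
    fix V assume V: "V \<in> Z1 \<Gamma> \<nu> \<alpha> K X"
    then obtain u where u: "u \<in> cocycles \<Gamma> \<nu> \<alpha> K X" "V = ae_equal \<Gamma> \<nu> \<alpha> K X `` {u}"
      unfolding Z1_def by (rule quotientE)
    then have "u \<in> V"
      using equiv_class_self[OF equiv_ae_equal] by simp
    define B where "B = {V \<in> Z1 \<Gamma> \<nu> \<alpha> K X.
      \<exists>v\<in>V. cocycle_dist \<nu> d \<one>\<^bsub>\<Gamma>\<^esub> u v < \<bar>cocycle_dist \<nu> d \<one>\<^bsub>\<Gamma>\<^esub> u u\<bar> + 1}"
    have "cocycle_dist \<nu> d \<one>\<^bsub>\<Gamma>\<^esub> u u < \<bar>cocycle_dist \<nu> d \<one>\<^bsub>\<Gamma>\<^esub> u u\<bar> + 1" by linarith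
    with V \<open>u \<in> V\<close> have "V \<in> B" unfolding B_def by blast
    moreover have "openin (cocycle_topology \<Gamma> \<nu> \<alpha> K X d) B"
      unfolding cocycle_topology_def
    proof (rule topology_generated_by_Basis, unfold mem_Collect_eq, intro exI conjI)
      show "B = {V \<in> Z1 \<Gamma> \<nu> \<alpha> K X.
        \<exists>v\<in>V. cocycle_dist \<nu> d \<one>\<^bsub>\<Gamma>\<^esub> u v < \<bar>cocycle_dist \<nu> d \<one>\<^bsub>\<Gamma>\<^esub> u u\<bar> + 1}"
        by (rule B_def)
      show "\<one>\<^bsub>\<Gamma>\<^esub> \<in> carrier \<Gamma>" by (simp add: assms group.is_monoid monoid.one_closed)
    qed (use u in auto)
    ultimately show "V \<in> topspace (cocycle_topology \<Gamma> \<nu> \<alpha> K X d)"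
      using openin_subset by blast
  qed
qed

context
  fixes \<Gamma> :: "('g, 'm) monoid_scheme" and \<nu> :: "'y measure" and \<alpha> :: "'g \<Rightarrow> 'y \<Rightarrow> 'y"
    and K :: "('k, 'n) monoid_scheme" and X :: "'k topology" and d :: "'k \<Rightarrow> 'k \<Rightarrow> real"
  assumes \<Gamma>: "group \<Gamma>" and \<nu>: "prob_space \<nu>" and X: "compact_space X" "compatible_metric X d"
begin

interpretation M: Metric_space "topspace X" d
  using X by (simp add: compatible_metric_def)

interpretation prob_space \<nu> by (rule \<nu>)

lemma mtopology_eq: "M.mtopology = X"
  using X by (simp add: compatible_metric_def)

lemma space_borel_sigma: "space (borel_sigma X) = topspace X"
  unfolding borel_sigma_def by (rule space_measure_of) (auto dest: openin_subset)

lemma section_measurable: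
  assumes "w \<in> cocycles \<Gamma> \<nu> \<alpha> K X" "\<gamma> \<in> carrier \<Gamma>"
  shows "(\<lambda>y. w (\<gamma>, y)) \<in> measurable \<nu> (borel_sigma X)"
proof -
  have "w \<in> measurable (count_space (carrier \<Gamma>) \<Otimes>\<^sub>M \<nu>) (borel_sigma X)"
    using assms by (simp add: cocycles_def)
  then show ?thesis
    by (rule measurable_compose[rotated]) (use assms in simp)
qed

lemma dist_measurable:
  assumes f: "f \<in> measurable \<nu> (borel_sigma X)" and g: "g \<in> measurable \<nu> (borel_sigma X)"
  shows "(\<lambda>y. d (f y) (g y)) \<in> borel_measurable \<nu>"
proof -
  have sp: "f y \<in> topspace X" "g y \<in> topspace X" if "y \<in> space \<nu>" for y
    using that f g by (auto dest!: measurable_space simp: space_borel_sigma)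
  have da: "(\<lambda>y. d a (h y)) \<in> borel_measurable \<nu>"
    if a: "a \<in> topspace X" and h: "h \<in> measurable \<nu> (borel_sigma X)" for a h
    unfolding borel_measurable_iff_less
  proof
    fix c
    have sph: "h y \<in> topspace X" if "y \<in> space \<nu>" for y
      using that h by (auto dest!: measurable_space simp: space_borel_sigma)
    have "{y \<in> space \<nu>. d a (h y) < c} = h -` M.mball a c \<inter> space \<nu>"
      using a sph by (auto simp: M.in_mball)
    moreover have "M.mball a c \<in> sets (borel_sigma X)"
      unfolding borel_sigma_def
      using M.openin_mball[of a c] by (auto simp: mtopology_eq intro!: in_measure_of dest: openin_subset)
    ultimately show "{y \<in> space \<nu>. d a (h y) < c} \<in> sets \<nu>"
      using h by (simp add: measurable_sets)
  qed
  have "M.mtotally_bounded (topspace X)"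
    using X(1) M.compactin_imp_mtotally_bounded by (simp add: mtopology_eq compact_space_def)
  then have "\<forall>n::nat. \<exists>F. finite F \<and> F \<subseteq> topspace X \<and>
      topspace X \<subseteq> (\<Union>x\<in>F. M.mball x (inverse (real (Suc n))))"
    unfolding M.mtotally_bounded_def by simp
  then obtain F where F: "\<And>n::nat. finite (F n)" "\<And>n. F n \<subseteq> topspace X"
      "\<And>n. topspace X \<subseteq> (\<Union>x\<in>F n. M.mball x (inverse (real (Suc n))))"
    by metis
  define D where "D = (\<Union>n. F n)"
  have D: "countable D" "D \<subseteq> topspace X"
    using F(1,2) by (auto simp: D_def intro: countable_finite)
  have dense: "\<exists>a\<in>D. d x a < e" if "x \<in> topspace X" "e > 0" for x e
  proof -
    obtain n where n: "inverse (real (Suc n)) < e" using reals_Archimedean[OF \<open>e > 0\<close>] by blast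
    obtain a where "a \<in> F n" "x \<in> M.mball a (inverse (real (Suc n)))"
      using F(3)[of n] \<open>x \<in> _\<close> by blast
    with n show ?thesis by (auto simp: D_def M.commute intro!: bexI[of _ a])
  qed
  show ?thesis
    unfolding borel_measurable_iff_less
  proof
    fix c
    have "{y \<in> space \<nu>. d (f y) (g y) < c}
        = (\<Union>a\<in>D. {y \<in> space \<nu>. d a (f y) + d a (g y) < c})" (is "?L = ?R")
    proof
      show "?R \<subseteq> ?L"
      proof safe
        fix a y assume "a \<in> D" "y \<in> space \<nu>" "d a (f y) + d a (g y) < c"
        then show "d (f y) (g y) < c"
          using M.triangle[of "f y" a "g y"] sp[of y] D(2) by (auto simp: M.commute)
      qed
      show "?L \<subseteq> ?R"
      proof
        fix y assume y: "y \<in> ?L"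
        define e where "e = (c - d (f y) (g y)) / 2"
        have "e > 0" "f y \<in> topspace X" "g y \<in> topspace X" using y sp by (auto simp: e_def)
        obtain a where a: "a \<in> D" "d (f y) a < e"
          using dense \<open>e > 0\<close> \<open>f y \<in> topspace X\<close> by blast
        have "d a (g y) \<le> d a (f y) + d (f y) (g y)"
          using M.triangle a D(2) \<open>f y \<in> topspace X\<close> \<open>g y \<in> topspace X\<close> by blast
        moreover have "d a (f y) = d (f y) a" by (simp add: M.commute)
        ultimately have "d a (f y) + d a (g y) < c" using a by (simp add: e_def field_simps)
        then show "y \<in> ?R" using a y by auto
      qed
    qed
    moreover have "{y \<in> space \<nu>. d a (f y) + d a (g y) < c} \<in> sets \<nu>" if "a \<in> D" for a
    proof -
      have [measurable]: "(\<lambda>y. d a (f y)) \<in> borel_measurable \<nu>" "(\<lambda>y. d a (g y)) \<in> borel_measurable \<nu>"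
        using da f g that D(2) by auto
      show ?thesis by measurable
    qed
    then have "?R \<in> sets \<nu>"
      using D(1) by (intro sets.countable_UN') auto
    ultimately show "{y \<in> space \<nu>. d (f y) (g y) < c} \<in> sets \<nu>"
      by simp
  qed
qed

lemma cocycle_dist_integrable:
  assumes "u \<in> cocycles \<Gamma> \<nu> \<alpha> K X" "v \<in> cocycles \<Gamma> \<nu> \<alpha> K X" "\<gamma> \<in> carrier \<Gamma>"
  shows "integrable \<nu> (\<lambda>y. d (u (\<gamma>, y)) (v (\<gamma>, y)))"
proof -
  have "compactin M.mtopology (topspace X)"
    using X(1) by (simp add: mtopology_eq compact_space_def)
  then have "M.mbounded (topspace X)" by (rule M.compactin_imp_mbounded)
  then obtain B where B: "\<And>x y. x \<in> topspace X \<Longrightarrow> y \<in> topspace X \<Longrightarrow> d x y \<le> B"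
    unfolding M.mbounded_alt by blast
  have "u (\<gamma>, y) \<in> topspace X" "v (\<gamma>, y) \<in> topspace X" if "y \<in> space \<nu>" for y
    using measurable_space[OF section_measurable that] assms by (auto simp: space_borel_sigma)
  then show ?thesis
    using assms B
    by (intro integrable_const_bound[of _ B] dist_measurable section_measurable AE_I2) auto
qed

lemma cocycle_dist_triangle:
  assumes "u \<in> cocycles \<Gamma> \<nu> \<alpha> K X" "v \<in> cocycles \<Gamma> \<nu> \<alpha> K X" "w \<in> cocycles \<Gamma> \<nu> \<alpha> K X"
    "\<gamma> \<in> carrier \<Gamma>"
  shows "cocycle_dist \<nu> d \<gamma> u w \<le> cocycle_dist \<nu> d \<gamma> u v + cocycle_dist \<nu> d \<gamma> v w"
proof -
  have sp: "u (\<gamma>, y) \<in> topspace X" "v (\<gamma>, y) \<in> topspace X" "w (\<gamma>, y) \<in> topspace X"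
    if "y \<in> space \<nu>" for y
    using measurable_space[OF section_measurable that] assms by (auto simp: space_borel_sigma)
  show ?thesis
    unfolding cocycle_dist_def using assms sp
    by (subst Bochner_Integration.integral_add[symmetric])
       (auto intro!: integral_mono cocycle_dist_integrable M.triangle)
qed

lemma cocycle_dist_commute: "cocycle_dist \<nu> d \<gamma> u v = cocycle_dist \<nu> d \<gamma> v u"
  unfolding cocycle_dist_def by (simp add: M.commute)

lemma cocycle_dist_nonneg: "cocycle_dist \<nu> d \<gamma> u v \<ge> 0"
  unfolding cocycle_dist_def by simp

lemma cocycle_dist_ae_equal:
  assumes "(u, v) \<in> ae_equal \<Gamma> \<nu> \<alpha> K X" "\<gamma> \<in> carrier \<Gamma>"
  shows "cocycle_dist \<nu> d \<gamma> u v = 0"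
proof -
  have uv: "u \<in> cocycles \<Gamma> \<nu> \<alpha> K X" "AE y in \<nu>. u (\<gamma>, y) = v (\<gamma>, y)"
    using assms by (auto simp: ae_equal_def)
  have "AE y in \<nu>. d (u (\<gamma>, y)) (v (\<gamma>, y)) = 0"
    using uv(2) AE_space
  proof eventually_elim
    case (elim y)
    have "u (\<gamma>, y) \<in> topspace X"
      using measurable_space[OF section_measurable[OF uv(1) assms(2)] elim(2)]
      by (simp add: space_borel_sigma)
    then show ?case using elim(1) by (metis M.zero)
  qed
  then show ?thesis unfolding cocycle_dist_def by (rule integral_eq_zero_AE)
qed

lemma Z1_rep:
  assumes "V \<in> Z1 \<Gamma> \<nu> \<alpha> K X" "v \<in> V"
  shows "v \<in> cocycles \<Gamma> \<nu> \<alpha> K X" "v' \<in> V \<Longrightarrow> (v, v') \<in> ae_equal \<Gamma> \<nu> \<alpha> K X"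
  using assms equiv_ae_equal unfolding Z1_def
  by (meson in_mono in_quotient_imp_subset, meson quotient_eq_iff)

lemma limitin_cocycle_topology:
  fixes W :: "nat \<Rightarrow> ('g \<times> 'y \<Rightarrow> 'k) set" and V :: "('g \<times> 'y \<Rightarrow> 'k) set"
  assumes W: "\<And>n. W n \<in> Z1 \<Gamma> \<nu> \<alpha> K X" "\<And>n. w n \<in> W n" and V: "V \<in> Z1 \<Gamma> \<nu> \<alpha> K X" "v \<in> V"
  shows "limitin (cocycle_topology \<Gamma> \<nu> \<alpha> K X d) W V sequentially \<longleftrightarrow>
         (\<forall>\<gamma>\<in>carrier \<Gamma>. (\<lambda>n. \<integral>y. d (w n (\<gamma>, y)) (v (\<gamma>, y)) \<partial>\<nu>) \<longlonglongrightarrow> 0)"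
    (is "?lim \<longleftrightarrow> ?conv")
proof -
  let ?B = "\<lambda>u \<gamma> \<epsilon>. {V \<in> Z1 \<Gamma> \<nu> \<alpha> K X. \<exists>v\<in>V. cocycle_dist \<nu> d \<gamma> u v < \<epsilon>}"
  let ?S = "{?B u \<gamma> \<epsilon> | u \<gamma> \<epsilon>. u \<in> cocycles \<Gamma> \<nu> \<alpha> K X \<and> \<gamma> \<in> carrier \<Gamma> \<and> \<epsilon> > 0}"
  have B_iff: "V' \<in> ?B u \<gamma> \<epsilon> \<longleftrightarrow> cocycle_dist \<nu> d \<gamma> u v' < \<epsilon>"
    if "V' \<in> Z1 \<Gamma> \<nu> \<alpha> K X" "v' \<in> V'" "u \<in> cocycles \<Gamma> \<nu> \<alpha> K X" "\<gamma> \<in> carrier \<Gamma>" for V' v' u \<gamma> \<epsilon>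
  proof -
    have "cocycle_dist \<nu> d \<gamma> u v' < \<epsilon>" if "v'' \<in> V'" "cocycle_dist \<nu> d \<gamma> u v'' < \<epsilon>" for v''
    proof -
      have *: "v'' \<in> cocycles \<Gamma> \<nu> \<alpha> K X" "v' \<in> cocycles \<Gamma> \<nu> \<alpha> K X" "(v'', v') \<in> ae_equal \<Gamma> \<nu> \<alpha> K X"
        using Z1_rep \<open>V' \<in> _\<close> \<open>v' \<in> V'\<close> \<open>v'' \<in> V'\<close> by blast+
      show ?thesis
        using cocycle_dist_triangle[OF \<open>u \<in> _\<close> *(1,2) \<open>\<gamma> \<in> _\<close>]
          cocycle_dist_ae_equal[OF *(3) \<open>\<gamma> \<in> _\<close>] that(2) by linarith
    qed
    then show ?thesis using that by blast
  qed
  have top: "topspace (cocycle_topology \<Gamma> \<nu> \<alpha> K X d) = Z1 \<Gamma> \<nu> \<alpha> K X"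
    using \<Gamma> by (rule topspace_cocycle_topology)
  have vc: "v \<in> cocycles \<Gamma> \<nu> \<alpha> K X" and wc: "\<And>n. w n \<in> cocycles \<Gamma> \<nu> \<alpha> K X"
    using Z1_rep W V by blast+
  have conv_iff: "?conv \<longleftrightarrow> (\<forall>\<gamma>\<in>carrier \<Gamma>. (\<lambda>n. cocycle_dist \<nu> d \<gamma> v (w n)) \<longlonglongrightarrow> 0)"
    unfolding cocycle_dist_def by (simp add: M.commute)
  show ?thesis
  proof
    assume lim: ?lim
    show ?conv
      unfolding conv_iff
    proof
      fix \<gamma> assume g: "\<gamma> \<in> carrier \<Gamma>"
      show "(\<lambda>n. cocycle_dist \<nu> d \<gamma> v (w n)) \<longlonglongrightarrow> 0"
      proof (rule order_tendstoI)
        fix a :: real assume "a < 0"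
        then show "eventually (\<lambda>n. a < cocycle_dist \<nu> d \<gamma> v (w n)) sequentially"
          by (intro always_eventually allI less_le_trans[OF _ cocycle_dist_nonneg])
      next
        fix a :: real assume a: "0 < a"
        have "openin (cocycle_topology \<Gamma> \<nu> \<alpha> K X d) (?B v \<gamma> a)"
          unfolding cocycle_topology_def
          by (rule topology_generated_by_Basis) (use vc g a in blast)
        moreover have "V \<in> ?B v \<gamma> a"
        proof -
          have "(v, v) \<in> ae_equal \<Gamma> \<nu> \<alpha> K X" using Z1_rep V by blast
          then show ?thesis using B_iff[OF V vc g] cocycle_dist_ae_equal g a by simp
        qed
        ultimately have "eventually (\<lambda>n. W n \<in> ?B v \<gamma> a) sequentially"
          using lim unfolding limitin_def by blast
        then show "eventually (\<lambda>n. cocycle_dist \<nu> d \<gamma> v (w n) < a) sequentially"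
          by eventually_elim (use B_iff[OF W vc g] in blast)
      qed
    qed
  next
    assume conv: ?conv
    have ev: "eventually (\<lambda>n. W n \<in> U) sequentially" if "generate_topology_on ?S U" "V \<in> U" for U
      using that
    proof (induction rule: generate_topology_on.induct)
      case (Int a b)
      then show ?case by (auto intro: eventually_conj)
    next
      case (UN L)
      then obtain k where "k \<in> L" "V \<in> k" by blast
      with UN have "eventually (\<lambda>n. W n \<in> k) sequentially" by blast
      then show ?case by eventually_elim (use \<open>k \<in> L\<close> in blast)
    next
      case (Basis s)
      then obtain u \<gamma> \<epsilon> where s: "s = ?B u \<gamma> \<epsilon>" "u \<in> cocycles \<Gamma> \<nu> \<alpha> K X" "\<gamma> \<in> carrier \<Gamma>" by blast
      have lt: "cocycle_dist \<nu> d \<gamma> u v < \<epsilon>" using Basis(2) B_iff[OF V s(2,3)] s(1) by blast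
      have "(\<lambda>n. cocycle_dist \<nu> d \<gamma> v (w n)) \<longlonglongrightarrow> 0" using conv s(3) unfolding conv_iff by blast
      then have "eventually (\<lambda>n. cocycle_dist \<nu> d \<gamma> v (w n) < \<epsilon> - cocycle_dist \<nu> d \<gamma> u v) sequentially"
        by (rule order_tendstoD) (use lt in simp)
      then have "eventually (\<lambda>n. W n \<in> ?B u \<gamma> \<epsilon>) sequentially"
      proof eventually_elim
        case (elim n)
        then show ?case
          using cocycle_dist_triangle[OF s(2) vc wc s(3), of n] B_iff[OF W s(2,3), of n \<epsilon>]
          by (smt (verit))
      qed
      then show ?case using s(1) by simp
    qed simp
    show ?lim
      unfolding limitin_def top
      using V(1) ev by (auto simp: cocycle_topology_def openin_topology_generated_by_iff)
  qed
qed

end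

end

theory Submission
  imports Defs "HOL-Library.Ramsey"
begin

text \<open>
  The compact group \<open>K\<close> carries a bi-invariant compatible metric \<open>\<rho>\<close>. Suppose that \<open>u n \<rightarrow> u'\<close>,
  \<open>v n \<rightarrow> v'\<close> and \<open>u n (\<gamma>, y) = \<theta> n (\<gamma> y) v n (\<gamma>, y) (\<theta> n y)\<^sup>-\<^sup>1\<close>. By bi-invariance
  \<open>\<rho> (\<theta> i (\<gamma> y)) (\<theta> j (\<gamma> y))\<close> and \<open>\<rho> (\<theta> i y) (\<theta> j y)\<close> differ by at most
  \<open>\<rho> (u i (\<gamma>, y)) (u j (\<gamma>, y)) + \<rho> (v i (\<gamma>, y)) (v j (\<gamma>, y))\<close>, so the functions
  \<open>y \<mapsto> \<rho> (\<theta> i y) (\<theta> j y)\<close> are almost invariant for large \<open>i, j\<close>, and strong ergodicity makes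
  them almost constant in measure. As \<open>K\<close> is totally bounded, every infinite set of indices contains
  a pair \<open>i, j\<close> for which this function is small on a set of mass bounded below, hence small
  outside a set of small mass. Ramsey's theorem turns such pairs into a subsequence of \<open>\<theta>\<close> that is
  Cauchy almost everywhere, and its limit \<open>\<theta>'\<close> satisfies
  \<open>u' (\<gamma>, y) = \<theta>' (\<gamma> y) v' (\<gamma>, y) (\<theta>' y)\<^sup>-\<^sup>1\<close>.
\<close>

section \<open>Bi-invariant metrics on compact groups\<close>

text \<open>Both translations sit in one equation, the form in which the supremum metric constructed
  below satisfies it; setting \<open>y\<close> or \<open>x\<close> to the identity separates the two
  sides.\<close>

locale biinvariant_metric_group = group K + Metric_space "carrier K" \<rho>
  for K :: "('k, 'n) monoid_scheme" (structure) and \<rho> :: "'k \<Rightarrow> 'k \<Rightarrow> real" +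
  assumes biinvariant: "\<lbrakk>x \<in> carrier K; a \<in> carrier K; b \<in> carrier K; y \<in> carrier K\<rbrakk>
    \<Longrightarrow> \<rho> (x \<otimes> a \<otimes> y) (x \<otimes> b \<otimes> y) = \<rho> a b"
begin

lemma left_invariant:
  assumes "x \<in> carrier K" "a \<in> carrier K" "b \<in> carrier K"
  shows "\<rho> (x \<otimes> a) (x \<otimes> b) = \<rho> a b"
  using biinvariant[of x a b \<one>] assms by simp

lemma right_invariant:
  assumes "y \<in> carrier K" "a \<in> carrier K" "b \<in> carrier K"
  shows "\<rho> (a \<otimes> y) (b \<otimes> y) = \<rho> a b"
  using biinvariant[of \<one> a b y] assms by simp

lemma dist_mult_le:
  assumes "a \<in> carrier K" "a' \<in> carrier K" "b \<in> carrier K" "b' \<in> carrier K"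
  shows "\<rho> (a \<otimes> b) (a' \<otimes> b') \<le> \<rho> a a' + \<rho> b b'"
  using triangle[of "a \<otimes> b" "a' \<otimes> b" "a' \<otimes> b'"] left_invariant right_invariant assms by simp

text \<open>Left multiplication by \<open>a\<close> and right multiplication by \<open>b\<close>
  carry the pair \<open>inv a\<close>, \<open>inv b\<close> to \<open>b\<close>,
  \<open>a\<close>.\<close>

lemma dist_inv:
  assumes "a \<in> carrier K" "b \<in> carrier K"
  shows "\<rho> (inv a) (inv b) = \<rho> a b"
proof -
  have "\<rho> (inv a) (inv b) = \<rho> (a \<otimes> inv a \<otimes> b) (a \<otimes> inv b \<otimes> b)"
    using biinvariant[of a "inv a" "inv b" b] assms by (simp only: inv_closed)
  also have "\<dots> = \<rho> b a" using assms by (simp add: m_assoc)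
  finally show ?thesis by (simp add: commute)
qed

lemma dist_twisted_conj_le:
  assumes "a \<in> carrier K" "a' \<in> carrier K" "x \<in> carrier K" "x' \<in> carrier K"
    "b \<in> carrier K" "b' \<in> carrier K"
  shows "\<rho> (a \<otimes> x \<otimes> inv b) (a' \<otimes> x' \<otimes> inv b') \<le> \<rho> a a' + \<rho> x x' + \<rho> b b'"
  using dist_mult_le[of "a \<otimes> x" "a' \<otimes> x'" "inv b" "inv b'"] dist_mult_le[of a a' x x'] assms
  by (simp add: dist_inv)

text \<open>The upper estimate is \<open>dist_twisted_conj_le\<close>. The lower one is the same
  estimate for the inverse transformation, which takes the products back to \<open>x\<close> and
  \<open>x'\<close>. Later \<open>a\<close> and \<open>b\<close> are values of the cocycles and
  \<open>x\<close> is a value of a transfer function.\<close>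

lemma abs_dist_twisted_conj_le:
  assumes "a \<in> carrier K" "a' \<in> carrier K" "x \<in> carrier K" "x' \<in> carrier K"
    "b \<in> carrier K" "b' \<in> carrier K"
  shows "\<bar>\<rho> (a \<otimes> x \<otimes> inv b) (a' \<otimes> x' \<otimes> inv b') - \<rho> x x'\<bar> \<le> \<rho> a a' + \<rho> b b'"
proof -
  let ?z = "a \<otimes> x \<otimes> inv b" and ?z' = "a' \<otimes> x' \<otimes> inv b'"
  \<comment> \<open>The double inverse stays unsimplified so that the term matches
    \<open>dist_twisted_conj_le\<close> with \<open>inv b\<close> in place of
    \<open>b\<close>.\<close>
  have cancel: "inv c \<otimes> (c \<otimes> y \<otimes> inv e) \<otimes> inv (inv e) = y"
    if "c \<in> carrier K" "y \<in> carrier K" "e \<in> carrier K" for c y e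
  proof -
    have "inv c \<otimes> (c \<otimes> y \<otimes> inv e) \<otimes> inv (inv e) = (inv c \<otimes> c) \<otimes> y \<otimes> (inv e \<otimes> e)"
      using that by (simp only: m_assoc inv_closed m_closed inv_inv)
    with that show ?thesis by simp
  qed
  have "\<rho> x x' \<le> \<rho> (inv a) (inv a') + \<rho> ?z ?z' + \<rho> (inv b) (inv b')"
    using dist_twisted_conj_le[of "inv a" "inv a'" ?z ?z' "inv b" "inv b'"] assms
    by (simp only: cancel inv_closed m_closed)
  moreover have "\<rho> ?z ?z' \<le> \<rho> a a' + \<rho> x x' + \<rho> b b'"
    using dist_twisted_conj_le assms by simp
  ultimately show ?thesis using assms by (simp add: dist_inv)
qed

end

section \<open>Existence of a bi-invariant compatible metric\<close>

lemma topological_group_triple_mult_continuous: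
  assumes "topological_group K X"
  shows "continuous_map (prod_topology X (prod_topology X X)) X (\<lambda>(x, a, y). x \<otimes>\<^bsub>K\<^esub> a \<otimes>\<^bsub>K\<^esub> y)"
proof -
  let ?P = "prod_topology X (prod_topology X X)" and ?m = "\<lambda>(x, y). x \<otimes>\<^bsub>K\<^esub> y"
  have m: "continuous_map (prod_topology X X) X ?m"
    using assms by (simp add: topological_group_def)
  have p: "continuous_map ?P X fst" "continuous_map ?P X (fst \<circ> snd)" "continuous_map ?P X (snd \<circ> snd)"
    by (auto intro!: continuous_map_compose continuous_map_fst continuous_map_snd)
  have "continuous_map ?P X (?m \<circ> (\<lambda>z. (fst z, (fst \<circ> snd) z)))"
    by (rule continuous_map_compose[OF _ m]) (use p in \<open>auto simp: continuous_map_pairwise o_def\<close>)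
  then have "continuous_map ?P X (?m \<circ> (\<lambda>z. ((?m \<circ> (\<lambda>z. (fst z, (fst \<circ> snd) z))) z, (snd \<circ> snd) z)))"
    by (intro continuous_map_compose[OF _ m]) (use p in \<open>auto simp: continuous_map_pairwise o_def\<close>)
  then show ?thesis by (simp add: o_def case_prod_unfold)
qed

lemma compact_metric_bounded:
  assumes "compact_space X" "compatible_metric X d"
  obtains B where "B > 0" "\<And>x y. x \<in> topspace X \<Longrightarrow> y \<in> topspace X \<Longrightarrow> d x y \<le> B"
proof -
  interpret Metric_space "topspace X" d using assms by (simp add: compatible_metric_def)
  have "mbounded (topspace X)"
    using assms by (intro compactin_imp_mbounded) (simp add: compatible_metric_def compact_space_def)
  then obtain B where "\<And>x y. x \<in> topspace X \<Longrightarrow> y \<in> topspace X \<Longrightarrow> d x y \<le> B"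
    unfolding mbounded_alt by blast
  then show thesis
    by (intro that[of "max B 1"]) (auto intro: le_max_iff_disj[THEN iffD2])
qed

text \<open>Heine-Cantor for the triple product on the compact cube of \<open>K\<close>, applied to
  triples that differ only in the middle entry and so have product distance \<open>d a b\<close>.
  The point is that \<open>\<delta>\<close> does not depend on the translating elements.\<close>

lemma topological_group_triple_mult_uniform:
  assumes K: "topological_group K X" and X: "compact_space X" "compatible_metric X d" and "\<epsilon> > 0"
  obtains \<delta> where "\<delta> > 0"
    "\<And>x a b y. \<lbrakk>x \<in> carrier K; a \<in> carrier K; b \<in> carrier K; y \<in> carrier K; d a b < \<delta>\<rbrakk>
       \<Longrightarrow> d (x \<otimes>\<^bsub>K\<^esub> a \<otimes>\<^bsub>K\<^esub> y) (x \<otimes>\<^bsub>K\<^esub> b \<otimes>\<^bsub>K\<^esub> y) < \<epsilon>"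
proof -
  interpret M: Metric_space "topspace X" d using X by (simp add: compatible_metric_def)
  have car: "topspace X = carrier K" using K by (simp add: topological_group_def)
  define m where "m = metric (topspace X, d)"
  have m: "mspace m = topspace X" "mdist m = d" "mtopology_of m = X"
    using X by (simp_all add: m_def mtopology_of_def compatible_metric_def)
  let ?f = "\<lambda>(x, a, y). x \<otimes>\<^bsub>K\<^esub> a \<otimes>\<^bsub>K\<^esub> y" and ?p = "prod_metric m (prod_metric m m)"
  have "continuous_map (mtopology_of ?p) (mtopology_of m) ?f"
    using topological_group_triple_mult_continuous[OF K] by (simp add: m)
  moreover have "compact_space (mtopology_of ?p)"
    using X(1) by (simp add: m compact_space_prod_topology)
  ultimately have "uniformly_continuous_map ?p m ?f"
    using continuous_eq_uniformly_continuous_map by blast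
  then obtain \<delta> where \<delta>: "\<delta> > 0" "\<And>z w. \<lbrakk>z \<in> mspace ?p; w \<in> mspace ?p; mdist ?p w z < \<delta>\<rbrakk> \<Longrightarrow> d (?f w) (?f z) < \<epsilon>"
    unfolding uniformly_continuous_map_def m(2) using \<open>\<epsilon> > 0\<close> by blast
  show thesis
  proof (rule that[OF \<delta>(1)])
    fix x a b y assume *: "x \<in> carrier K" "a \<in> carrier K" "b \<in> carrier K" "y \<in> carrier K" "d a b < \<delta>"
    have "mdist ?p (x, a, y) (x, b, y) = d a b"
      using * car by (simp add: prod_dist_def m)
    with * \<delta>(2)[of "(x, b, y)" "(x, a, y)"] car
    show "d (x \<otimes>\<^bsub>K\<^esub> a \<otimes>\<^bsub>K\<^esub> y) (x \<otimes>\<^bsub>K\<^esub> b \<otimes>\<^bsub>K\<^esub> y) < \<epsilon>"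
      by (simp add: m)
  qed
qed

text \<open>By \<open>le\<close>, balls of \<open>\<rho>\<close> lie in balls of \<open>d\<close> of
  the same radius; by \<open>small\<close>, each ball of \<open>\<rho>\<close> contains a concentric
  ball of \<open>d\<close>. Hence the open sets agree.\<close>

lemma compatible_metricI:
  assumes "compatible_metric X d" and \<rho>: "Metric_space (topspace X) \<rho>"
    and le: "\<And>x y. x \<in> topspace X \<Longrightarrow> y \<in> topspace X \<Longrightarrow> d x y \<le> \<rho> x y"
    and small: "\<And>\<epsilon>. \<epsilon> > 0 \<Longrightarrow> \<exists>\<delta>>0. \<forall>x\<in>topspace X. \<forall>y\<in>topspace X. d x y < \<delta> \<longrightarrow> \<rho> x y < \<epsilon>"
  shows "compatible_metric X \<rho>"
proof -
  interpret M: Metric_space "topspace X" d using assms by (simp add: compatible_metric_def)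
  interpret R: Metric_space "topspace X" \<rho> by (rule \<rho>)
  have "openin R.mtopology U \<longleftrightarrow> openin M.mtopology U" for U
    unfolding R.openin_mtopology M.openin_mtopology
  proof (rule conj_cong[OF refl], rule iff_allI, rule imp_cong[OF refl], rule iffI)
    assume U: "U \<subseteq> topspace X"
    fix x
    assume "\<exists>r>0. R.mball x r \<subseteq> U"
    then obtain r where r: "r > 0" "R.mball x r \<subseteq> U" by blast
    obtain \<delta> where "\<delta> > 0" "\<forall>x\<in>topspace X. \<forall>y\<in>topspace X. d x y < \<delta> \<longrightarrow> \<rho> x y < r"
      using small[OF r(1)] by blast
    then have "M.mball x \<delta> \<subseteq> R.mball x r" by auto
    with r \<open>\<delta> > 0\<close> show "\<exists>r>0. M.mball x r \<subseteq> U" by blast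
  next
    fix x
    assume "\<exists>r>0. M.mball x r \<subseteq> U"
    then obtain r where r: "r > 0" "M.mball x r \<subseteq> U" by blast
    have "R.mball x r \<subseteq> M.mball x r" 
    proof
      fix y assume "y \<in> R.mball x r"
      with le[of x y] show "y \<in> M.mball x r" by simp
    qed
    with r show "\<exists>r>0. R.mball x r \<subseteq> U" by blast
  qed
  then have "R.mtopology = M.mtopology" by (simp add: topology_eq)
  then show ?thesis using assms(1) \<rho> by (simp add: compatible_metric_def)
qed

text \<open>\<open>\<rho> a b\<close> is the supremum of \<open>d\<close> over all two-sided
  translates of the pair, finite because \<open>d\<close> is bounded. The uniform comparison with
  \<open>d\<close> is exported as well, since it later transfers convergence in mean from
  \<open>d\<close> to \<open>\<rho>\<close>.\<close>

lemma biinvariant_metric_exists: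
  fixes K :: "('k, 'n) monoid_scheme" (structure)
  assumes K: "topological_group K X" and X: "compact_space X" "compatible_metric X d"
  obtains \<rho> where "biinvariant_metric_group K \<rho>" "compatible_metric X \<rho>"
    "\<And>\<epsilon>. \<epsilon> > 0 \<Longrightarrow> \<exists>\<delta>>0. \<forall>x\<in>topspace X. \<forall>y\<in>topspace X. d x y < \<delta> \<longrightarrow> \<rho> x y < \<epsilon>"
proof -
  interpret M: Metric_space "topspace X" d using X by (simp add: compatible_metric_def)
  interpret K: group K using K by (simp add: topological_group_def)
  have car: "topspace X = carrier K" using K by (simp add: topological_group_def)
  obtain B where B: "B > 0" "\<And>x y. x \<in> topspace X \<Longrightarrow> y \<in> topspace X \<Longrightarrow> d x y \<le> B"
    using compact_metric_bounded[OF X] by metis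
  let ?C = "carrier K \<times> carrier K"
  define S where "S a b = (\<lambda>(x, y). d (x \<otimes> a \<otimes> y) (x \<otimes> b \<otimes> y)) ` ?C" for a b
  \<comment> \<open>\<open>Metric_space\<close> demands nonnegativity and symmetry for all
    arguments, so a default value is fixed outside the carrier.\<close>
  define \<rho> where "\<rho> a b = (if a \<in> carrier K \<and> b \<in> carrier K then Sup (S a b) else 0)" for a b
  have ne: "S a b \<noteq> {}" for a b unfolding S_def using K.one_closed by blast
  have bdd: "bdd_above (S a b)" if "a \<in> carrier K" "b \<in> carrier K" for a b
    using that B(2) by (intro bdd_aboveI[of _ B]) (auto simp: S_def car)
  have upper: "d (x \<otimes> a \<otimes> y) (x \<otimes> b \<otimes> y) \<le> \<rho> a b"
    if "x \<in> carrier K" "a \<in> carrier K" "b \<in> carrier K" "y \<in> carrier K" for x a b y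
    using cSup_upper[OF _ bdd] that by (force simp: \<rho>_def S_def)
  have least: "\<rho> a b \<le> c"
    if "a \<in> carrier K" "b \<in> carrier K"
      "\<And>x y. x \<in> carrier K \<Longrightarrow> y \<in> carrier K \<Longrightarrow> d (x \<otimes> a \<otimes> y) (x \<otimes> b \<otimes> y) \<le> c" for a b c
  proof -
    have "Sup (S a b) \<le> c" using that(3) by (intro cSup_least[OF ne]) (auto simp: S_def)
    with that show ?thesis by (simp add: \<rho>_def)
  qed
  have d_le: "d a b \<le> \<rho> a b" if "a \<in> carrier K" "b \<in> carrier K" for a b
    using upper[of \<one> a b \<one>] that by simp
  have metric: "Metric_space (carrier K) \<rho>"
  proof
    fix a b
    show "0 \<le> \<rho> a b"
      using d_le[of a b] order_trans[OF M.nonneg[of a b]] by (cases "a \<in> carrier K \<and> b \<in> carrier K") (auto simp: \<rho>_def)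
    show "\<rho> a b = \<rho> b a"
      by (simp add: \<rho>_def S_def M.commute)
  next
    fix a b assume ab: "a \<in> carrier K" "b \<in> carrier K"
    have "a = b" if "\<rho> a b = 0"
      using d_le[OF ab] that ab M.zero M.nonneg[of a b] car by (metis order_antisym)
    moreover have "\<rho> a a = 0"
    proof (rule antisym)
      show "\<rho> a a \<le> 0" using ab car by (intro least) auto
      show "0 \<le> \<rho> a a" using d_le[of a a] ab M.nonneg[of a a] by linarith
    qed
    ultimately show "\<rho> a b = 0 \<longleftrightarrow> a = b" by blast
  next
    fix a b c assume abc: "a \<in> carrier K" "b \<in> carrier K" "c \<in> carrier K"
    show "\<rho> a c \<le> \<rho> a b + \<rho> b c"
    proof (rule least)
      fix x y assume xy: "x \<in> carrier K" "y \<in> carrier K"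
      have "d (x \<otimes> a \<otimes> y) (x \<otimes> c \<otimes> y)
          \<le> d (x \<otimes> a \<otimes> y) (x \<otimes> b \<otimes> y) + d (x \<otimes> b \<otimes> y) (x \<otimes> c \<otimes> y)"
        using abc xy car by (intro M.triangle) auto
      also have "\<dots> \<le> \<rho> a b + \<rho> b c" using upper abc xy by (intro add_mono) auto
      finally show "d (x \<otimes> a \<otimes> y) (x \<otimes> c \<otimes> y) \<le> \<rho> a b + \<rho> b c" .
    qed (use abc in auto)
  qed
  \<comment> \<open>The translates of the translated pair are among the translates of the original
    pair, so the supremum cannot grow.\<close>
  have contract: "\<rho> (p \<otimes> a \<otimes> q) (p \<otimes> b \<otimes> q) \<le> \<rho> a b"
    if "p \<in> carrier K" "a \<in> carrier K" "b \<in> carrier K" "q \<in> carrier K" for p a b q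
  proof (rule least)
    fix x y assume xy: "x \<in> carrier K" "y \<in> carrier K"
    have *: "x \<otimes> (p \<otimes> c \<otimes> q) \<otimes> y = (x \<otimes> p) \<otimes> c \<otimes> (q \<otimes> y)" if "c \<in> carrier K" for c
      using that xy \<open>p \<in> _\<close> \<open>q \<in> _\<close> by (simp add: K.m_assoc)
    show "d (x \<otimes> (p \<otimes> a \<otimes> q) \<otimes> y) (x \<otimes> (p \<otimes> b \<otimes> q) \<otimes> y) \<le> \<rho> a b"
      using upper[of "x \<otimes> p" a b "q \<otimes> y"] that xy by (simp add: *)
  qed (use that in auto)
  have biinv: "\<rho> (p \<otimes> a \<otimes> q) (p \<otimes> b \<otimes> q) = \<rho> a b"
    if "p \<in> carrier K" "a \<in> carrier K" "b \<in> carrier K" "q \<in> carrier K" for p a b q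
  proof (rule antisym)
    have *: "inv p \<otimes> (p \<otimes> c \<otimes> q) \<otimes> inv q = c" if "c \<in> carrier K" for c
    proof -
      have "inv p \<otimes> (p \<otimes> c \<otimes> q) \<otimes> inv q = (inv p \<otimes> p) \<otimes> c \<otimes> (q \<otimes> inv q)"
        using that \<open>p \<in> _\<close> \<open>q \<in> _\<close> by (simp only: K.m_assoc K.inv_closed K.m_closed)
      with that \<open>p \<in> _\<close> \<open>q \<in> _\<close> show ?thesis by simp
    qed
    \<comment> \<open>Contraction under the inverse translation gives the reverse
      inequality.\<close>
    show "\<rho> a b \<le> \<rho> (p \<otimes> a \<otimes> q) (p \<otimes> b \<otimes> q)"
      using contract[of "inv p" "p \<otimes> a \<otimes> q" "p \<otimes> b \<otimes> q" "inv q"] that by (simp add: *)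
  qed (rule contract[OF that])
  have small: "\<exists>\<delta>>0. \<forall>x\<in>topspace X. \<forall>y\<in>topspace X. d x y < \<delta> \<longrightarrow> \<rho> x y < \<epsilon>" if "\<epsilon> > 0" for \<epsilon>
  proof -
    \<comment> \<open>Half of \<open>\<epsilon>\<close>, because a supremum of values below a bound
      may attain that bound.\<close>
    obtain \<delta> where \<delta>: "\<delta> > 0" "\<And>x a b y. \<lbrakk>x \<in> carrier K; a \<in> carrier K; b \<in> carrier K; y \<in> carrier K; d a b < \<delta>\<rbrakk>
       \<Longrightarrow> d (x \<otimes> a \<otimes> y) (x \<otimes> b \<otimes> y) < \<epsilon> / 2"
      using topological_group_triple_mult_uniform[OF K X half_gt_zero[OF \<open>\<epsilon> > 0\<close>]] by metis
    have "\<rho> a b < \<epsilon>" if "a \<in> carrier K" "b \<in> carrier K" "d a b < \<delta>" for a b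
    proof -
      have "\<rho> a b \<le> \<epsilon> / 2" using \<delta>(2) that by (intro least) (auto intro: less_imp_le)
      then show ?thesis using \<open>\<epsilon> > 0\<close> by simp
    qed
    then show ?thesis using \<delta>(1) car by auto
  qed
  show thesis
  proof
    show "biinvariant_metric_group K \<rho>"
      using metric biinv by (intro biinvariant_metric_group.intro biinvariant_metric_group_axioms.intro) auto
    show "compatible_metric X \<rho>"
      by (rule compatible_metricI[OF X(2)]) (use metric d_le small car in auto)
  qed (rule small)
qed

section \<open>Strong ergodicity for functions\<close>

text \<open>Links the images in the definition of strong ergodicity with preimages, which suit
  measurability and level sets of functions.\<close>

lemma image_eq_vimage_inv:
  assumes "group_action \<Gamma> E \<alpha>" "\<gamma> \<in> carrier \<Gamma>" "A \<subseteq> E"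
  shows "\<alpha> \<gamma> ` A = \<alpha> (inv\<^bsub>\<Gamma>\<^esub> \<gamma>) -` A \<inter> E"
proof -
  interpret group_action \<Gamma> E \<alpha> by (rule assms(1))
  interpret \<Gamma>: group \<Gamma> using group_hom by (simp add: group_hom_def)
  have one: "\<alpha> \<one>\<^bsub>\<Gamma>\<^esub> y = y" if "y \<in> E" for y
    using id_eq_one that by (metis restrict_apply')
  have cl: "\<alpha> g y \<in> E" if "g \<in> carrier \<Gamma>" "y \<in> E" for g y
    using element_image that by blast
  have cancel: "\<alpha> (inv\<^bsub>\<Gamma>\<^esub> \<gamma>) (\<alpha> \<gamma> y) = y" "\<alpha> \<gamma> (\<alpha> (inv\<^bsub>\<Gamma>\<^esub> \<gamma>) y) = y" if "y \<in> E" for y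
    using composition_rule[symmetric] one that assms(2) by simp_all
  show ?thesis
  proof (intro equalityI subsetI)
    fix y assume "y \<in> \<alpha> \<gamma> ` A"
    then show "y \<in> \<alpha> (inv\<^bsub>\<Gamma>\<^esub> \<gamma>) -` A \<inter> E" using cancel(1) cl assms(2,3) by auto
  next
    fix y assume y: "y \<in> \<alpha> (inv\<^bsub>\<Gamma>\<^esub> \<gamma>) -` A \<inter> E"
    with cancel(2) have "y = \<alpha> \<gamma> (\<alpha> (inv\<^bsub>\<Gamma>\<^esub> \<gamma>) y)" by simp
    with y show "y \<in> \<alpha> \<gamma> ` A" by blast
  qed
qed

text \<open>A quantitative form of strong ergodicity. If no finite set and tolerance worked for
  \<open>\<kappa>\<close>, counterexamples for the finite sets \<open>F n\<close>, which exhaust the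
  group, with tolerances tending to 0 would form an almost invariant sequence violating the
  definition.\<close>

lemma strongly_ergodicE:
  fixes \<Gamma> :: "('g, 'm) monoid_scheme"
  assumes \<Gamma>: "countable (carrier \<Gamma>)"
    and pmp: "pmp_action \<Gamma> \<nu> \<alpha>" and se: "strongly_ergodic \<Gamma> \<nu> \<alpha>" and "\<kappa> > 0"
  obtains F \<delta> where "finite F" "F \<subseteq> carrier \<Gamma>" "\<delta> > 0"
    "\<And>A. \<lbrakk>A \<in> sets \<nu>; \<And>\<gamma>. \<gamma> \<in> F \<Longrightarrow> measure \<nu> (sym_diff (\<alpha> \<gamma> -` A \<inter> space \<nu>) A) < \<delta>\<rbrakk>
       \<Longrightarrow> measure \<nu> A * (1 - measure \<nu> A) < \<kappa>"
proof -
  have act: "group_action \<Gamma> (space \<nu>) \<alpha>" using pmp by (simp add: pmp_action_def)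
  interpret \<Gamma>: group \<Gamma>
    using act by (simp add: group_action_def group_hom_def)
  \<comment> \<open>The enumeration may repeat elements, which covers finite groups too.\<close>
  define e where "e = from_nat_into (carrier \<Gamma>)"
  define F where "F n = e ` {..n}" for n
  have F: "finite (F n)" "F n \<subseteq> carrier \<Gamma>" for n
    unfolding F_def e_def using from_nat_into[of "carrier \<Gamma>"] \<Gamma>.one_closed by blast+
  let ?P = "\<lambda>n A. A \<in> sets \<nu> \<and>
    (\<forall>\<gamma>\<in>F n. measure \<nu> (sym_diff (\<alpha> \<gamma> -` A \<inter> space \<nu>) A) < inverse (real (Suc n)))"
  have "\<exists>n. \<forall>A. ?P n A \<longrightarrow> measure \<nu> A * (1 - measure \<nu> A) < \<kappa>"
  proof (rule ccontr)
    assume "\<nexists>n. \<forall>A. ?P n A \<longrightarrow> measure \<nu> A * (1 - measure \<nu> A) < \<kappa>"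
    then obtain A where A: "\<And>n. ?P n (A n)" "\<And>n. \<not> measure \<nu> (A n) * (1 - measure \<nu> (A n)) < \<kappa>"
      by metis
    have "(\<lambda>n. measure \<nu> (sym_diff (\<alpha> \<gamma> ` A n) (A n))) \<longlonglongrightarrow> 0" if g: "\<gamma> \<in> carrier \<Gamma>" for \<gamma>
    proof -
      \<comment> \<open>The translate by \<open>\<gamma>\<close> is the preimage under the inverse,
        so the index of the inverse decides from which \<open>n\<close> on the bound
        applies.\<close>
      obtain i where i: "inv\<^bsub>\<Gamma>\<^esub> \<gamma> = e i"
        using from_nat_into_surj[OF \<Gamma>, of "inv\<^bsub>\<Gamma>\<^esub> \<gamma>"] g unfolding e_def by (metis \<Gamma>.inv_closed)
      have "measure \<nu> (sym_diff (\<alpha> \<gamma> ` A n) (A n)) \<le> inverse (real (Suc n))" if "n \<ge> i" for n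
      proof -
        have "\<alpha> \<gamma> ` A n = \<alpha> (e i) -` A n \<inter> space \<nu>"
          using image_eq_vimage_inv[OF act g, of "A n"] A(1)[of n] i by (simp add: sets.sets_into_space)
        moreover have "e i \<in> F n" using that by (simp add: F_def)
        ultimately show ?thesis using A(1)[of n] by (simp add: less_imp_le)
      qed
      then show ?thesis
        by (intro tendsto_sandwich[OF _ _ tendsto_const LIMSEQ_inverse_real_of_nat])
           (auto simp: eventually_sequentially)
    qed
    then have "(\<lambda>n. measure \<nu> (A n) * (1 - measure \<nu> (A n))) \<longlonglongrightarrow> 0"
      using se A(1) unfolding strongly_ergodic_def by blast
    then have "eventually (\<lambda>n. measure \<nu> (A n) * (1 - measure \<nu> (A n)) < \<kappa>) sequentially"
      using \<open>\<kappa> > 0\<close> by (rule order_tendstoD)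
    then show False using A(2) by (simp add: eventually_sequentially)
  qed
  then obtain n where "\<forall>A. ?P n A \<longrightarrow> measure \<nu> A * (1 - measure \<nu> A) < \<kappa>" by blast
  then show thesis using F by (intro that[of "F n" "inverse (real (Suc n))"]) auto
qed

text \<open>Some sublevel set of an almost invariant \<open>f\<close>, at a height between
  \<open>a\<close> and \<open>b\<close>, is almost invariant. It has mass at least \<open>c\<close>,
  so its complement, which contains the set where \<open>f\<close> is at least \<open>b\<close>,
  must be small. \<open>F\<close> and \<open>\<eta>\<close> are chosen before \<open>f\<close>,
  because they decide how late the indices defining \<open>f\<close> must be.\<close>

lemma strongly_ergodic_function:
  fixes \<Gamma> :: "('g, 'm) monoid_scheme"
  assumes \<Gamma>: "countable (carrier \<Gamma>)" and \<nu>: "prob_space \<nu>"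
    and pmp: "pmp_action \<Gamma> \<nu> \<alpha>" and se: "strongly_ergodic \<Gamma> \<nu> \<alpha>"
    and ab: "a < b" and c: "c > 0" "c' > 0"
  shows "\<exists>F \<eta>. finite F \<and> F \<subseteq> carrier \<Gamma> \<and> \<eta> > 0 \<and>
    (\<forall>f :: 'y \<Rightarrow> real. f \<in> borel_measurable \<nu> \<longrightarrow>
       (\<forall>\<gamma>\<in>F. measure \<nu> {y \<in> space \<nu>. \<eta> \<le> \<bar>f (\<alpha> \<gamma> y) - f y\<bar>} < \<eta>) \<longrightarrow>
       c \<le> measure \<nu> {y \<in> space \<nu>. f y < a} \<longrightarrow>
       measure \<nu> {y \<in> space \<nu>. b \<le> f y} < c')"
proof -
  interpret prob_space \<nu> by (rule \<nu>)
  \<comment> \<open>With the bound \<open>c * c'\<close>, a set of mass at least \<open>c\<close>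
    has a complement of mass below \<open>c'\<close>.\<close>
  obtain F \<delta> where F: "finite F" "F \<subseteq> carrier \<Gamma>" and "\<delta> > 0" and
    F\<delta>: "\<And>A. \<lbrakk>A \<in> sets \<nu>; \<And>\<gamma>. \<gamma> \<in> F \<Longrightarrow> measure \<nu> (sym_diff (\<alpha> \<gamma> -` A \<inter> space \<nu>) A) < \<delta>\<rbrakk>
       \<Longrightarrow> measure \<nu> A * (1 - measure \<nu> A) < c * c'"
    using strongly_ergodicE[OF \<Gamma> pmp se, of "c * c'"] c by (metis mult_pos_pos)
  obtain n where "inverse (real (Suc n)) < \<delta> / 2"
    using reals_Archimedean[of "\<delta> / 2"] \<open>\<delta> > 0\<close> by auto
  define L where "L = Suc n"
  have L: "L > 0" "1 / real L < \<delta> / 2"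
    using \<open>inverse _ < _\<close> by (simp_all add: L_def inverse_eq_divide)
  \<comment> \<open>Half the width of a window: \<open>L\<close> windows of width
    \<open>2 * h\<close> fill the interval from \<open>a\<close> to \<open>b\<close>. As
    \<open>\<eta> \<le> h\<close>, a move across the midpoint by less than \<open>\<eta>\<close>
    starts inside the window; the bounds by \<open>\<delta> / 2\<close> share
    \<open>\<delta>\<close> between the window and the set where \<open>f\<close> moves far.\<close>
  define h where "h = (b - a) / (2 * real L)"
  have "h > 0" using ab L by (simp add: h_def)
  define \<eta> where "\<eta> = min h (\<delta> / 2)"
  have \<eta>: "\<eta> > 0" "\<eta> \<le> h" "\<eta> \<le> \<delta> / 2" using \<open>h > 0\<close> \<open>\<delta> > 0\<close> by (auto simp: \<eta>_def)
  show ?thesis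
  proof (intro exI[of _ F] exI[of _ \<eta>] conjI allI impI F \<eta>(1))
    fix f :: "'y \<Rightarrow> real"
    assume f [measurable]: "f \<in> borel_measurable \<nu>"
      and inv: "\<forall>\<gamma>\<in>F. measure \<nu> {y \<in> space \<nu>. \<eta> \<le> \<bar>f (\<alpha> \<gamma> y) - f y\<bar>} < \<eta>"
      and low: "c \<le> measure \<nu> {y \<in> space \<nu>. f y < a}"
    \<comment> \<open>One of these \<open>L\<close> disjoint windows carries at most \<open>1 / L\<close> of the mass. The level set at its
      midpoint \<open>t\<close> changes under \<open>\<gamma>\<close> only where \<open>f\<close> moves by at least \<open>\<eta>\<close> or takes values in the window.\<close>
    define W where "W k = {y \<in> space \<nu>. a + 2 * real k * h \<le> f y \<and> f y < a + 2 * real (Suc k) * h}" for k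
    have W [measurable]: "W k \<in> sets \<nu>" for k unfolding W_def by measurable
    have "disjoint_family_on W {..<L}"
      unfolding disjoint_family_on_def
    proof (intro ballI impI)
      fix i j :: nat assume "i \<noteq> j"
      have "W i \<inter> W j = {}" if "i < j" for i j
      proof -
        have "real (Suc i) * h \<le> real j * h" using that \<open>h > 0\<close> by (intro mult_right_mono) auto
        then show ?thesis by (auto simp: W_def distrib_right mult.assoc)
      qed
      then show "W i \<inter> W j = {}" using \<open>i \<noteq> j\<close> by (metis Int_commute linorder_neqE_nat)
    qed
    then have "prob (\<Union> (W ` {..<L})) = (\<Sum>k<L. prob (W k))"
      by (intro finite_measure_finite_Union) (auto simp: W)
    then have sum: "(\<Sum>k<L. prob (W k)) \<le> 1"
      using prob_le_1[of "\<Union> (W ` {..<L})"] by simp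
    have "\<exists>k<L. prob (W k) \<le> 1 / real L"
    proof (rule ccontr)
      assume "\<not> (\<exists>k<L. prob (W k) \<le> 1 / real L)"
      then have "(\<Sum>k<L. 1 / real L) < (\<Sum>k<L. prob (W k))"
        using L(1) by (intro sum_strict_mono) (auto simp: not_le)
      with sum L(1) show False by simp
    qed
    then obtain k where k: "k < L" "prob (W k) \<le> 1 / real L" by blast
    define t where "t = a + (2 * real k + 1) * h"
    define A where "A = {y \<in> space \<nu>. f y < t}"
    have A [measurable]: "A \<in> sets \<nu>" unfolding A_def by measurable
    have "a \<le> t" using \<open>h > 0\<close> by (simp add: t_def)
    have "(2 * real k + 1) * h \<le> (2 * real L) * h"
      using k(1) \<open>h > 0\<close> by (intro mult_right_mono) auto
    then have "t \<le> b" using L(1) by (simp add: t_def h_def)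
    have "prob (sym_diff (\<alpha> \<gamma> -` A \<inter> space \<nu>) A) < \<delta>" if g: "\<gamma> \<in> F" for \<gamma>
    proof -
      have [measurable]: "\<alpha> \<gamma> \<in> measurable \<nu> \<nu>"
        using pmp g F(2) by (auto simp: pmp_action_def)
      let ?D = "{y \<in> space \<nu>. \<eta> \<le> \<bar>f (\<alpha> \<gamma> y) - f y\<bar>}"
      have "sym_diff (\<alpha> \<gamma> -` A \<inter> space \<nu>) A \<subseteq> ?D \<union> W k"
      proof
        fix y assume y: "y \<in> sym_diff (\<alpha> \<gamma> -` A \<inter> space \<nu>) A"
        then have sp: "y \<in> space \<nu>" "\<alpha> \<gamma> y \<in> space \<nu>"
          using measurable_space[of "\<alpha> \<gamma>" \<nu> \<nu>] by (auto simp: A_def)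
        have "t - h \<le> f y \<and> f y < t + h" if "\<bar>f (\<alpha> \<gamma> y) - f y\<bar> < \<eta>"
          using y sp that \<eta>(2) by (auto simp: A_def)
        then show "y \<in> ?D \<union> W k"
          using sp by (auto simp: W_def t_def algebra_simps)
      qed
      then have "prob (sym_diff (\<alpha> \<gamma> -` A \<inter> space \<nu>) A) \<le> prob (?D \<union> W k)"
        by (intro finite_measure_mono) auto
      also have "\<dots> \<le> prob ?D + prob (W k)"
        by (intro measure_Un_le) auto
      also have "\<dots> < \<delta>" using bspec[OF inv g] k(2) L(2) \<eta>(3) by linarith
      finally show ?thesis .
    qed
    then have "prob A * (1 - prob A) < c * c'" by (rule F\<delta>[OF A])
    moreover have "c \<le> prob A"
      using low by (rule order_trans) (use \<open>a \<le> t\<close> in \<open>auto simp: A_def intro!: finite_measure_mono\<close>)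
    moreover have "prob {y \<in> space \<nu>. b \<le> f y} \<le> 1 - prob A"
    proof -
      have "prob {y \<in> space \<nu>. b \<le> f y} \<le> prob (space \<nu> - A)"
        by (intro finite_measure_mono) (use \<open>t \<le> b\<close> in \<open>auto simp: A_def\<close>)
      then show ?thesis by (simp add: prob_compl)
    qed
    ultimately have "c * prob {y \<in> space \<nu>. b \<le> f y} < c * c'"
      using c(1) by (smt (verit) mult_mono measure_nonneg)
    then show "prob {y \<in> space \<nu>. b \<le> f y} < c'" using c(1) by simp
  qed
qed

section \<open>Measurable maps into a compact metric space\<close>

lemma measurable_dist:
  assumes "prob_space \<nu>" "compact_space X" "compatible_metric X d"
    "f \<in> measurable \<nu> (borel_sigma X)" "g \<in> measurable \<nu> (borel_sigma X)"
  shows "(\<lambda>y. d (f y) (g y)) \<in> borel_measurable \<nu>"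
  \<comment> \<open>The group premise of \<open>dist_measurable\<close> is instantiated with a group
    of bijections, since no acting group is at hand here.\<close>
  using dist_measurable[OF group_BijGroup assms] .

lemma space_borel_sigma_topspace: "space (borel_sigma X) = topspace X"
  unfolding borel_sigma_def by (rule space_measure_of) (auto dest: openin_subset)

lemma (in Metric_space) compact_finite_net:
  assumes "compact_space mtopology" "\<epsilon> > 0"
  shows "\<exists>F. finite F \<and> F \<subseteq> M \<and> M \<subseteq> (\<Union>a\<in>F. mball a \<epsilon>)"
  using compactin_imp_mtotally_bounded[of M] assms
  unfolding mtotally_bounded_def by (auto simp: compact_space_def)

text \<open>Finite nets at the scales \<open>1 / (n + 1)\<close> write every open set as a countable
  union of balls, and preimages of balls are sublevel sets of distance functions.\<close>

lemma measurable_borel_sigmaI: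
  assumes "compact_space X" "compatible_metric X d"
    and f: "f \<in> space \<nu> \<rightarrow> topspace X"
    and dist: "\<And>a. a \<in> topspace X \<Longrightarrow> (\<lambda>y. d a (f y)) \<in> borel_measurable \<nu>"
  shows "f \<in> measurable \<nu> (borel_sigma X)"
  unfolding borel_sigma_def
proof (rule measurable_measure_of)
  interpret M: Metric_space "topspace X" d using assms by (simp add: compatible_metric_def)
  have top: "M.mtopology = X" using assms by (simp add: compatible_metric_def)
  fix U assume "U \<in> {U. openin X U}"
  then have U: "openin M.mtopology U" by (simp add: top)
  define r where "r n = inverse (real (Suc n))" for n
  have "\<exists>F. finite F \<and> F \<subseteq> topspace X \<and> topspace X \<subseteq> (\<Union>a\<in>F. M.mball a (r n))" for n
    using M.compact_finite_net[of "r n"] assms(1) by (simp add: top r_def)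
  then obtain F where F: "finite (F n)" "F n \<subseteq> topspace X" "topspace X \<subseteq> (\<Union>a\<in>F n. M.mball a (r n))" for n
    by metis
  define G where "G n = {a \<in> F n. M.mball a (r n) \<subseteq> U}" for n
  have "U \<subseteq> (\<Union>n. \<Union>a\<in>G n. M.mball a (r n))"
  proof
    fix x assume x: "x \<in> U"
    then obtain e where e: "e > 0" "M.mball x e \<subseteq> U" using U unfolding M.openin_mtopology by blast
    \<comment> \<open>Half of \<open>e\<close>, so that a ball of radius \<open>r n\<close>
      containing \<open>x\<close> stays within distance \<open>e\<close> of
      \<open>x\<close>.\<close>
    obtain n where n: "r n < e / 2" using reals_Archimedean[of "e / 2"] e by (auto simp: r_def)
    have "x \<in> topspace X" using x U by (auto simp: M.openin_mtopology)
    then obtain a where a: "a \<in> F n" "x \<in> M.mball a (r n)" using F(3) by blast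
    then have "M.mball a (r n) \<subseteq> M.mball x e"
      using n by (intro M.mball_subset) auto
    with a e show "x \<in> (\<Union>n. \<Union>a\<in>G n. M.mball a (r n))" unfolding G_def by blast
  qed
  then have U_eq: "U = (\<Union>n. \<Union>a\<in>G n. M.mball a (r n))"
    by (auto simp: G_def)
  have "f -` U \<inter> space \<nu> = (\<Union>n. \<Union>a\<in>G n. {y \<in> space \<nu>. d a (f y) < r n})"
  proof -
    have "f y \<in> M.mball a (r n) \<longleftrightarrow> d a (f y) < r n" if "y \<in> space \<nu>" "a \<in> G n" for y a n
      using that f F(2) by (auto simp: G_def)
    then show ?thesis unfolding U_eq by blast
  qed
  moreover have "{y \<in> space \<nu>. d a (f y) < r n} \<in> sets \<nu>" if "a \<in> G n" for a n
  proof -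
    have [measurable]: "(\<lambda>y. d a (f y)) \<in> borel_measurable \<nu>"
      using that F(2) by (intro dist) (auto simp: G_def)
    show ?thesis by measurable
  qed
  moreover have "finite (G n)" for n using F(1) by (simp add: G_def)
  ultimately show "f -` U \<inter> space \<nu> \<in> sets \<nu>"
    by (auto intro!: sets.countable_UN sets.finite_UN)
qed (use f in \<open>auto dest: openin_subset\<close>)

lemma (in Metric_space) MCauchy_geometric:
  assumes s: "range s \<subseteq> M" and ev: "eventually (\<lambda>n. d (s n) (s (Suc n)) < (1/2) ^ n) sequentially"
  shows "MCauchy s"
  unfolding MCauchy_def
proof (intro conjI allI impI)
  fix \<epsilon> :: real assume "\<epsilon> > 0"
  obtain N where N: "d (s n) (s (Suc n)) < (1/2) ^ n" if "n \<ge> N" for n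
    using ev by (auto simp: eventually_sequentially)
  have sM: "s n \<in> M" for n using s by blast
  \<comment> \<open>The bound is the exact geometric sum from \<open>m\<close> to
    \<open>n - 1\<close>; keeping its subtracted term lets the induction close.\<close>
  have le: "d (s m) (s n) \<le> 2 * (1/2) ^ m - 2 * (1/2) ^ n" if "N \<le> m" "m \<le> n" for m n
    using \<open>m \<le> n\<close>
  proof (induction n rule: dec_induct)
    case base
    then show ?case using sM by simp
  next
    case (step n)
    have "d (s m) (s (Suc n)) \<le> d (s m) (s n) + d (s n) (s (Suc n))"
      using sM by (intro triangle)
    also have "\<dots> \<le> (2 * (1/2) ^ m - 2 * (1/2) ^ n) + (1/2) ^ n"
      using step N[of n] \<open>N \<le> m\<close> by (intro add_mono) auto
    finally show ?case by simp
  qed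
  have "(\<lambda>n. 2 * (1/2::real) ^ n) \<longlonglongrightarrow> 2 * 0"
    by (intro tendsto_mult tendsto_const LIMSEQ_power_zero) simp
  then have "eventually (\<lambda>n. 2 * (1/2) ^ n < \<epsilon>) sequentially"
    using \<open>\<epsilon> > 0\<close> by (intro order_tendstoD(2)) auto
  then obtain L where L: "2 * (1/2) ^ n < \<epsilon>" if "n \<ge> L" for n
    by (auto simp: eventually_sequentially)
  have "d (s m) (s n) < \<epsilon>" if "max N L \<le> m" "m \<le> n" for m n
  proof -
    have "d (s m) (s n) \<le> 2 * (1/2) ^ m - 2 * (1/2) ^ n" using that by (intro le) auto
    also have "\<dots> \<le> 2 * (1/2) ^ m" by simp
    also have "\<dots> < \<epsilon>" using that by (intro L) auto
    finally show ?thesis .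
  qed
  then show "\<exists>N. \<forall>n n'. N \<le> n \<longrightarrow> N \<le> n' \<longrightarrow> d (s n) (s n') < \<epsilon>"
    by (metis commute linorder_linear)
qed (use s in auto)

text \<open>Compactness gives completeness, hence pointwise limits. The limit map is measurable
  because its distance to each fixed point is a limit of measurable real functions.\<close>

lemma measurable_AE_limit:
  assumes "prob_space \<nu>" and X: "compact_space X" "compatible_metric X d"
    and h: "\<And>n :: nat. h n \<in> measurable \<nu> (borel_sigma X)"
    and ae: "AE y in \<nu>. Metric_space.MCauchy (topspace X) d (\<lambda>n. h n y)"
  obtains \<theta> where "\<theta> \<in> measurable \<nu> (borel_sigma X)" "AE y in \<nu>. (\<lambda>n. d (h n y) (\<theta> y)) \<longlonglongrightarrow> 0"
proof -
  interpret prob_space \<nu> by fact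
  interpret M: Metric_space "topspace X" d using X by (simp add: compatible_metric_def)
  have top: "M.mtopology = X" using X by (simp add: compatible_metric_def)
  have complete: M.mcomplete using X(1) by (intro M.compact_space_imp_mcomplete) (simp add: top)
  obtain N where N: "\<And>y. y \<in> space \<nu> - N \<Longrightarrow> M.MCauchy (\<lambda>n. h n y)" "N \<in> null_sets \<nu>"
    using AE_E3[OF ae] by metis
  have hX: "h n y \<in> topspace X" if "y \<in> space \<nu>" for n y
    using measurable_space[OF h that] by (simp add: space_borel_sigma_topspace)
  \<comment> \<open>Off the null set \<open>N\<close> the sequence is kept; on \<open>N\<close> it is made constant, so that it converges everywhere.\<close>
  define g where "g n y = (if y \<in> N then h 0 y else h n y)" for n y
  have g: "g n \<in> measurable \<nu> (borel_sigma X)" for n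
    unfolding g_def using N(2) h by (intro measurable_If_set) auto
  have "\<exists>l. l \<in> topspace X \<and> (\<lambda>n. d (g n y) l) \<longlonglongrightarrow> 0" if "y \<in> space \<nu>" for y
  proof (cases "y \<in> N")
    case True
    then show ?thesis using hX[OF that, of 0] by (auto simp: g_def)
  next
    case False
    then have "M.MCauchy (\<lambda>n. h n y)" using N(1) that by simp
    then obtain l where "limitin M.mtopology (\<lambda>n. h n y) l sequentially"
      using complete unfolding M.mcomplete_def by meson
    with False show ?thesis by (auto simp: M.limitin_metric_dist_null g_def)
  qed
  then obtain \<theta> where \<theta>: "\<And>y. y \<in> space \<nu> \<Longrightarrow> \<theta> y \<in> topspace X"
      "\<And>y. y \<in> space \<nu> \<Longrightarrow> (\<lambda>n. d (g n y) (\<theta> y)) \<longlonglongrightarrow> 0"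
    by metis
  show thesis
  proof
    show "\<theta> \<in> measurable \<nu> (borel_sigma X)"
    proof (rule measurable_borel_sigmaI[OF X])
      fix a assume a: "a \<in> topspace X"
      show "(\<lambda>y. d a (\<theta> y)) \<in> borel_measurable \<nu>"
      proof (rule borel_measurable_LIMSEQ_real)
        show "(\<lambda>y. d a (g n y)) \<in> borel_measurable \<nu>" for n
          using a g by (intro measurable_dist[OF assms(1) X])
            (auto simp: space_borel_sigma_topspace)
        fix y assume y: "y \<in> space \<nu>"
        have gX: "g n y \<in> topspace X" for n using hX y by (simp add: g_def)
        have "(\<lambda>n. d a (g n y) - d a (\<theta> y)) \<longlonglongrightarrow> 0"
        proof (rule Lim_null_comparison[OF always_eventually \<theta>(2)[OF y]], rule allI)
          show "norm (d a (g n y) - d a (\<theta> y)) \<le> d (g n y) (\<theta> y)" for n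
            using M.mdist_reverse_triangle[of "g n y" a "\<theta> y"] a gX \<theta>(1)[OF y]
            by (simp add: M.commute)
        qed
        then show "(\<lambda>n. d a (g n y)) \<longlonglongrightarrow> d a (\<theta> y)" by (simp add: LIM_zero_iff)
      qed
    qed (use \<theta> in auto)
    show "AE y in \<nu>. (\<lambda>n. d (h n y) (\<theta> y)) \<longlonglongrightarrow> 0"
      using AE_not_in[OF N(2)] AE_space
    proof eventually_elim
      case (elim y)
      then show ?case using \<theta>(2)[of y] by (simp add: g_def)
    qed
  qed
qed

section \<open>Close pairs of functions and Ramsey selection\<close>

text \<open>Among \<open>m\<close> of the functions, the sets where some pair is close cover the
  space. There are at most \<open>m * m\<close> such pairs, so one set has mass at least
  \<open>1 / (m * m)\<close>. This \<open>c\<close> depends only on \<open>\<epsilon>\<close> and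
  the metric, so it can be fixed before the functions and indices.\<close>

lemma close_pair_exists:
  assumes "prob_space \<nu>" and X: "compact_space X" "compatible_metric X d" and "\<epsilon> > 0"
  shows "\<exists>c>0. \<forall>(h :: nat \<Rightarrow> 'y \<Rightarrow> 'k) I. infinite I \<longrightarrow> (\<forall>i. h i \<in> measurable \<nu> (borel_sigma X)) \<longrightarrow>
    (\<exists>i\<in>I. \<exists>j\<in>I. i \<noteq> j \<and> c \<le> measure \<nu> {y \<in> space \<nu>. d (h i y) (h j y) < \<epsilon>})"
proof -
  interpret prob_space \<nu> by fact
  interpret M: Metric_space "topspace X" d using X by (simp add: compatible_metric_def)
  have top: "M.mtopology = X" using X by (simp add: compatible_metric_def)
  obtain F where F: "finite F" "F \<subseteq> topspace X" "topspace X \<subseteq> (\<Union>a\<in>F. M.mball a (\<epsilon> / 2))"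
    using M.compact_finite_net[of "\<epsilon> / 2"] X(1) \<open>\<epsilon> > 0\<close> unfolding top by (metis half_gt_zero)
  \<comment> \<open>At every point two of any \<open>m\<close> of the functions take values in the same ball.\<close>
  define m where "m = Suc (card F)"
  define c where "c = 1 / real (m * m)"
  have "m > 0" by (simp add: m_def)
  then have "c > 0" by (simp add: c_def)
  show ?thesis
  proof (intro exI[of _ c] conjI allI impI)
    fix h :: "nat \<Rightarrow> 'y \<Rightarrow> 'k" and I :: "nat set"
    assume "infinite I" and "\<forall>i. h i \<in> measurable \<nu> (borel_sigma X)"
    then have h: "h i \<in> measurable \<nu> (borel_sigma X)" for i by blast
    obtain J where J: "finite J" "card J = m" "J \<subseteq> I" using \<open>infinite I\<close> infinite_arbitrarily_large by blast
    define P where "P = {p \<in> J \<times> J. fst p \<noteq> snd p}"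
    have P: "finite P" "card P \<le> m * m"
      using J card_mono[of "J \<times> J" P] by (auto simp: P_def card_cartesian_product)
    define S where "S p = {y \<in> space \<nu>. d (h (fst p) y) (h (snd p) y) < \<epsilon>}" for p
    have S: "S p \<in> sets \<nu>" for p
    proof -
      have [measurable]: "(\<lambda>y. d (h (fst p) y) (h (snd p) y)) \<in> borel_measurable \<nu>"
        by (intro measurable_dist[OF assms(1) X] h)
      show ?thesis unfolding S_def by measurable
    qed
    have "space \<nu> \<subseteq> (\<Union>p\<in>P. S p)"
    proof
      fix y assume y: "y \<in> space \<nu>"
      have hX: "h i y \<in> topspace X" for i
        using measurable_space[OF h y] by (simp add: space_borel_sigma_topspace)
      have "\<forall>i. \<exists>a\<in>F. d a (h i y) < \<epsilon> / 2" using F(3) hX by fastforce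
      then obtain a where a: "\<And>i. a i \<in> F" "\<And>i. d (a i) (h i y) < \<epsilon> / 2" by metis
      have "card (a ` J) \<le> card F" using a(1) F(1) by (intro card_mono) auto
      then have "\<not> inj_on a J" by (intro pigeonhole) (simp add: J m_def)
      then obtain i j where ij: "i \<in> J" "j \<in> J" "i \<noteq> j" "a i = a j" by (auto simp: inj_on_def)
      have "d (h i y) (h j y) \<le> d (a i) (h i y) + d (a i) (h j y)"
        using hX a(1) F(2) by (intro M.triangle'') auto
      also have "\<dots> < \<epsilon>" using a(2)[of i] a(2)[of j] ij(4) by simp
      finally have "y \<in> S (i, j)" using y by (simp add: S_def)
      moreover have "(i, j) \<in> P" using ij by (simp add: P_def)
      ultimately show "y \<in> (\<Union>p\<in>P. S p)" by blast
    qed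
    then have "prob (space \<nu>) \<le> prob (\<Union>p\<in>P. S p)"
      using S P(1) by (intro finite_measure_mono) auto
    also have "\<dots> \<le> (\<Sum>p\<in>P. prob (S p))"
      using S P(1) by (intro measure_UNION_le) auto
    finally have ge: "1 \<le> (\<Sum>p\<in>P. prob (S p))" by (simp add: prob_space)
    have "\<exists>p\<in>P. c \<le> prob (S p)"
    proof (rule ccontr)
      assume "\<not> (\<exists>p\<in>P. c \<le> prob (S p))"
      moreover have "P \<noteq> {}" using ge by auto
      ultimately have "(\<Sum>p\<in>P. prob (S p)) < (\<Sum>p\<in>P. c)"
        using P(1) by (intro sum_strict_mono) (auto simp: not_le)
      also have "\<dots> \<le> real (m * m) * c"
        using P(2) \<open>c > 0\<close> by (simp only: sum_constant) (intro mult_right_mono, auto simp only: of_nat_le_iff less_imp_le)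
      also have "\<dots> = 1" using \<open>m > 0\<close> by (simp add: c_def)
      finally show False using ge by simp
    qed
    then obtain p where "p \<in> P" "c \<le> prob (S p)" by blast
    with J(3) show "\<exists>i\<in>I. \<exists>j\<in>I. i \<noteq> j \<and> c \<le> prob {y \<in> space \<nu>. d (h i y) (h j y) < \<epsilon>}"
      by (intro bexI[of _ "fst p"] bexI[of _ "snd p"]) (auto simp: P_def S_def)
  qed (rule \<open>c > 0\<close>)
qed

text \<open>Ramsey's theorem is applied once for each \<open>k\<close> inside the previous infinite
  set; \<open>pair\<close> excludes the homogeneous colour of unrelated pairs. Since the sets are
  nested, \<open>r k\<close> and \<open>r (Suc k)\<close> both lie in the set homogeneous for
  \<open>R k\<close>.\<close>

lemma infinite_homogeneous_chain:
  fixes R :: "nat \<Rightarrow> nat \<Rightarrow> nat \<Rightarrow> bool"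
  assumes sym: "\<And>k i j. R k i j \<Longrightarrow> R k j i"
    and pair: "\<And>k I. infinite I \<Longrightarrow> \<exists>i\<in>I. \<exists>j\<in>I. i \<noteq> j \<and> R k i j"
  obtains r :: "nat \<Rightarrow> nat" where "strict_mono r" "\<And>k. R k (r k) (r (Suc k))"
proof -
  have ram: "\<exists>J\<subseteq>I. infinite J \<and> (\<forall>i\<in>J. \<forall>j\<in>J. i \<noteq> j \<longrightarrow> R k i j)" if "infinite I" for I k
  proof -
    \<comment> \<open>Colour 0 marks related pairs; \<open>sym\<close> makes the colour of an
      unordered pair independent of its presentation.\<close>
    define f :: "nat set \<Rightarrow> nat" where "f e = (if \<exists>i j. e = {i, j} \<and> R k i j then 0 else 1)" for e
    have f: "f {i, j} = 0 \<longleftrightarrow> R k i j" for i j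
      using sym by (auto simp: f_def doubleton_eq_iff)
    have "\<forall>i\<in>I. \<forall>j\<in>I. i \<noteq> j \<longrightarrow> f {i, j} < 2" by (simp add: f_def)
    from Ramsey2[OF that this] obtain J t where
      J: "J \<subseteq> I" "infinite J" "\<forall>i\<in>J. \<forall>j\<in>J. i \<noteq> j \<longrightarrow> f {i, j} = t" by blast
    with pair[OF J(2), of k] f show ?thesis by (metis (no_types, lifting))
  qed
  \<comment> \<open>The state at stage \<open>k\<close> is an infinite set homogeneous for
    \<open>R k\<close> with a chosen element. The next choice is made in that set above the old
    element, which makes the choices strictly increasing.\<close>
  let ?P = "\<lambda>k (I, n). infinite I \<and> n \<in> I \<and> (\<forall>i\<in>I. \<forall>j\<in>I. i \<noteq> j \<longrightarrow> R k i j)"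
  let ?Q = "\<lambda>(k :: nat) (I, n) (J, m). m \<in> I \<and> n < m"
  have "\<exists>s. \<forall>k. ?P k (s k) \<and> ?Q k (s k) (s (Suc k))"
  proof (rule dependent_nat_choice)
    obtain J where "infinite J" "\<forall>i\<in>J. \<forall>j\<in>J. i \<noteq> j \<longrightarrow> R 0 i j"
      using ram[of UNIV 0] by auto
    moreover then obtain n where "n \<in> J" by (metis finite.emptyI ex_in_conv)
    ultimately show "\<exists>x. ?P 0 x" by auto
  next
    fix x k assume "?P k x"
    then obtain I n where x: "x = (I, n)" "infinite I" by auto
    have "infinite (I \<inter> {n<..})"
    proof
      assume "finite (I \<inter> {n<..})"
      then have "finite (I \<inter> {n<..} \<union> {..n})" by simp
      with x(2) show False by (elim notE finite_subset[rotated]) auto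
    qed
    then obtain J where J: "J \<subseteq> I \<inter> {n<..}" "infinite J" "\<forall>i\<in>J. \<forall>j\<in>J. i \<noteq> j \<longrightarrow> R (Suc k) i j"
      using ram by meson
    then obtain m where "m \<in> J" by (metis finite.emptyI ex_in_conv)
    with J x show "\<exists>y. ?P (Suc k) y \<and> ?Q k x y" by (intro exI[of _ "(J, m)"]) auto
  qed
  then obtain s where "\<forall>k. ?P k (s k) \<and> ?Q k (s k) (s (Suc k))" by (rule exE)
  then have s: "?P k (s k)" "?Q k (s k) (s (Suc k))" for k by simp_all
  show thesis
  proof
    show "strict_mono (snd \<circ> s)"
      using s(2) by (simp add: strict_mono_Suc_iff split_def)
    show "R k ((snd \<circ> s) k) ((snd \<circ> s) (Suc k))" for k
      using s(1)[of k] s(2)[of k] by (auto simp: split_def)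
  qed
qed

section \<open>Limits of cohomologous cocycles\<close>

text \<open>Convergence is stated for the bi-invariant \<open>\<rho>\<close>;
  \<open>cocycle_dist_tendsto_0_change_metric\<close> supplies it from an arbitrary compatible
  metric.\<close>

locale cohomologous_limit = prob_space \<nu> + biinvariant_metric_group K \<rho>
  for \<nu> :: "'y measure" and K :: "('k, 'n) monoid_scheme" (structure) and \<rho> :: "'k \<Rightarrow> 'k \<Rightarrow> real" +
  fixes \<Gamma> :: "('g, 'm) monoid_scheme" and \<alpha> :: "'g \<Rightarrow> 'y \<Rightarrow> 'y" and X :: "'k topology"
    and u v :: "nat \<Rightarrow> 'g \<times> 'y \<Rightarrow> 'k" and \<theta> :: "nat \<Rightarrow> 'y \<Rightarrow> 'k" and u' v' :: "'g \<times> 'y \<Rightarrow> 'k"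
  assumes \<Gamma>: "group \<Gamma>" "countable (carrier \<Gamma>)"
    and pmp: "pmp_action \<Gamma> \<nu> \<alpha>" and se: "strongly_ergodic \<Gamma> \<nu> \<alpha>"
    and X: "compact_space X" "compatible_metric X \<rho>" and topspace: "topspace X = carrier K"
    and u: "\<And>n. u n \<in> cocycles \<Gamma> \<nu> \<alpha> K X" and u': "u' \<in> cocycles \<Gamma> \<nu> \<alpha> K X"
    and v: "\<And>n. v n \<in> cocycles \<Gamma> \<nu> \<alpha> K X" and v': "v' \<in> cocycles \<Gamma> \<nu> \<alpha> K X"
    and \<theta>: "\<And>n. \<theta> n \<in> measurable \<nu> (borel_sigma X)"
    and coh: "\<And>n \<gamma>. \<gamma> \<in> carrier \<Gamma> \<Longrightarrow>
      AE y in \<nu>. u n (\<gamma>, y) = \<theta> n (\<alpha> \<gamma> y) \<otimes> v n (\<gamma>, y) \<otimes> inv (\<theta> n y)"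
    and lim_u: "\<And>\<gamma>. \<gamma> \<in> carrier \<Gamma> \<Longrightarrow> (\<lambda>n. cocycle_dist \<nu> \<rho> \<gamma> (u n) u') \<longlonglongrightarrow> 0"
    and lim_v: "\<And>\<gamma>. \<gamma> \<in> carrier \<Gamma> \<Longrightarrow> (\<lambda>n. cocycle_dist \<nu> \<rho> \<gamma> (v n) v') \<longlonglongrightarrow> 0"
begin

text \<open>One function for both sequences: by the triangle inequality, \<open>err i\<close> plus
  \<open>err j\<close> dominates the distance of \<open>u i\<close> and \<open>u j\<close> plus that
  of \<open>v i\<close> and \<open>v j\<close>.\<close>

definition err :: "nat \<Rightarrow> 'g \<Rightarrow> 'y \<Rightarrow> real" where
  "err n \<gamma> y = \<rho> (u n (\<gamma>, y)) (u' (\<gamma>, y)) + \<rho> (v n (\<gamma>, y)) (v' (\<gamma>, y))"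

lemma err_nonneg: "0 \<le> err n \<gamma> y"
  by (simp add: err_def)

lemma integrable_dist:
  assumes "w \<in> cocycles \<Gamma> \<nu> \<alpha> K X" "w' \<in> cocycles \<Gamma> \<nu> \<alpha> K X" "\<gamma> \<in> carrier \<Gamma>"
  shows "integrable \<nu> (\<lambda>y. \<rho> (w (\<gamma>, y)) (w' (\<gamma>, y)))"
  by (rule cocycle_dist_integrable[OF \<Gamma>(1) prob_space_axioms X assms])

lemma integrable_err:
  assumes "\<gamma> \<in> carrier \<Gamma>"
  shows "integrable \<nu> (err n \<gamma>)"
  unfolding err_def
  by (intro Bochner_Integration.integrable_add integrable_dist u v u' v' assms)

lemma err_tendsto_0:
  assumes "\<gamma> \<in> carrier \<Gamma>"
  shows "(\<lambda>n. \<integral>y. err n \<gamma> y \<partial>\<nu>) \<longlonglongrightarrow> 0"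
proof -
  have "(\<integral>y. err n \<gamma> y \<partial>\<nu>) = cocycle_dist \<nu> \<rho> \<gamma> (u n) u' + cocycle_dist \<nu> \<rho> \<gamma> (v n) v'" for n
    unfolding err_def cocycle_dist_def
    by (intro Bochner_Integration.integral_add integrable_dist
        u v u' v' assms)
  then show ?thesis using tendsto_add[OF lim_u lim_v] assms by simp
qed

lemma section_closed:
  assumes "w \<in> cocycles \<Gamma> \<nu> \<alpha> K X" "\<gamma> \<in> carrier \<Gamma>" "y \<in> space \<nu>"
  shows "w (\<gamma>, y) \<in> carrier K"
  using measurable_space[OF section_measurable[OF \<Gamma>(1) prob_space_axioms X assms(1,2)] assms(3)]
  by (simp add: space_borel_sigma_topspace topspace)

lemma \<theta>_closed: "y \<in> space \<nu> \<Longrightarrow> \<theta> n y \<in> carrier K"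
  using measurable_space[OF \<theta>] by (simp add: space_borel_sigma_topspace topspace)

lemma action_measurable: "\<gamma> \<in> carrier \<Gamma> \<Longrightarrow> \<alpha> \<gamma> \<in> measurable \<nu> \<nu>"
  using pmp by (simp add: pmp_action_def)

text \<open>Preimages of null sets under a measure-preserving map are null. This carries convergence
  of the transfer functions from \<open>y\<close> to \<open>\<alpha> \<gamma> y\<close>.\<close>

lemma action_AE:
  assumes "\<gamma> \<in> carrier \<Gamma>" "AE y in \<nu>. P y"
  shows "AE y in \<nu>. P (\<alpha> \<gamma> y)"
proof (rule AE_distrD[OF action_measurable[OF assms(1)]])
  have "distr \<nu> \<nu> (\<alpha> \<gamma>) = \<nu>" using pmp assms(1) by (simp add: pmp_action_def)
  then show "AE y in distr \<nu> \<nu> (\<alpha> \<gamma>). P y" using assms(2) by (rule ssubst)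
qed

lemma almost_invariant:
  assumes g: "\<gamma> \<in> carrier \<Gamma>"
  shows "AE y in \<nu>. \<bar>\<rho> (\<theta> i (\<alpha> \<gamma> y)) (\<theta> j (\<alpha> \<gamma> y)) - \<rho> (\<theta> i y) (\<theta> j y)\<bar> \<le> err i \<gamma> y + err j \<gamma> y"
  using coh[OF g, of i] coh[OF g, of j] AE_space
proof eventually_elim
  case (elim y)
  note y = elim(3)
  have gy: "\<alpha> \<gamma> y \<in> space \<nu>" using measurable_space[OF action_measurable[OF g] y] .
  note closed = \<theta>_closed[OF y] \<theta>_closed[OF gy] section_closed[OF u g y] section_closed[OF v g y]
    section_closed[OF u' g y] section_closed[OF v' g y]
  \<comment> \<open>Solved for its value at \<open>\<alpha> \<gamma> y\<close>, the transfer
    function appears as the middle factor \<open>\<theta> n y\<close> between two cocycle values, as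
    \<open>abs_dist_twisted_conj_le\<close> requires.\<close>
  have solve: "\<theta> n (\<alpha> \<gamma> y) = u n (\<gamma>, y) \<otimes> \<theta> n y \<otimes> inv (v n (\<gamma>, y))"
    if "u n (\<gamma>, y) = \<theta> n (\<alpha> \<gamma> y) \<otimes> v n (\<gamma>, y) \<otimes> inv (\<theta> n y)" for n
    using that closed by (simp add: inv_solve_right inv_solve_right')
  have "\<bar>\<rho> (\<theta> i (\<alpha> \<gamma> y)) (\<theta> j (\<alpha> \<gamma> y)) - \<rho> (\<theta> i y) (\<theta> j y)\<bar>
      \<le> \<rho> (u i (\<gamma>, y)) (u j (\<gamma>, y)) + \<rho> (v i (\<gamma>, y)) (v j (\<gamma>, y))"
    unfolding solve[OF elim(1)] solve[OF elim(2)] using closed by (intro abs_dist_twisted_conj_le)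
  also have "\<dots> \<le> err i \<gamma> y + err j \<gamma> y"
    using triangle'[of "u i (\<gamma>, y)" "u' (\<gamma>, y)" "u j (\<gamma>, y)"]
      triangle'[of "v i (\<gamma>, y)" "v' (\<gamma>, y)" "v j (\<gamma>, y)"] closed
    by (simp add: err_def)
  finally show ?case .
qed

text \<open>Compactness gives a pair within \<open>\<epsilon> / 2\<close> on mass at least
  \<open>c\<close>; strong ergodicity, with the levels \<open>\<epsilon> / 2\<close> and
  \<open>\<epsilon>\<close>, improves this to a pair within \<open>\<epsilon>\<close> off mass
  \<open>\<epsilon>\<close>.\<close>

lemma close_pair:
  assumes "infinite I" and "\<epsilon> > 0"
  shows "\<exists>i\<in>I. \<exists>j\<in>I. i \<noteq> j \<and> prob {y \<in> space \<nu>. \<epsilon> \<le> \<rho> (\<theta> i y) (\<theta> j y)} < \<epsilon>"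
proof -
  obtain c where c: "c > 0" "\<forall>(h :: nat \<Rightarrow> 'y \<Rightarrow> 'k) I. infinite I \<longrightarrow> (\<forall>i. h i \<in> measurable \<nu> (borel_sigma X)) \<longrightarrow>
      (\<exists>i\<in>I. \<exists>j\<in>I. i \<noteq> j \<and> c \<le> prob {y \<in> space \<nu>. \<rho> (h i y) (h j y) < \<epsilon> / 2})"
    using close_pair_exists[OF prob_space_axioms X half_gt_zero[OF \<open>\<epsilon> > 0\<close>]] by (elim exE conjE)
  have "\<epsilon> / 2 < \<epsilon>" using \<open>\<epsilon> > 0\<close> by simp
  obtain F \<eta> where F: "finite F" "F \<subseteq> carrier \<Gamma>" "\<eta> > 0" and
    F\<eta>: "\<forall>f :: 'y \<Rightarrow> real. f \<in> borel_measurable \<nu> \<longrightarrow>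
       (\<forall>\<gamma>\<in>F. prob {y \<in> space \<nu>. \<eta> \<le> \<bar>f (\<alpha> \<gamma> y) - f y\<bar>} < \<eta>) \<longrightarrow>
       c \<le> prob {y \<in> space \<nu>. f y < \<epsilon> / 2} \<longrightarrow> prob {y \<in> space \<nu>. \<epsilon> \<le> f y} < \<epsilon>"
    using strongly_ergodic_function[OF \<Gamma>(2) prob_space_axioms pmp se \<open>\<epsilon> / 2 < \<epsilon>\<close> c(1) \<open>\<epsilon> > 0\<close>]
    by (elim exE conjE)
  \<comment> \<open>Two such errors have total integral below \<open>\<eta> * \<eta>\<close>, so
    Markov's inequality at level \<open>\<eta>\<close> leaves mass below
    \<open>\<eta>\<close>.\<close>
  have "eventually (\<lambda>n. \<forall>\<gamma>\<in>F. (\<integral>y. err n \<gamma> y \<partial>\<nu>) < \<eta> * \<eta> / 2) sequentially"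
  proof (intro eventually_ball_finite[OF F(1)] ballI)
    fix \<gamma> assume "\<gamma> \<in> F"
    then show "eventually (\<lambda>n. (\<integral>y. err n \<gamma> y \<partial>\<nu>) < \<eta> * \<eta> / 2) sequentially"
      using F(2,3) by (intro order_tendstoD(2)[OF err_tendsto_0]) auto
  qed
  then obtain M where M: "\<And>n \<gamma>. \<lbrakk>n \<ge> M; \<gamma> \<in> F\<rbrakk> \<Longrightarrow> (\<integral>y. err n \<gamma> y \<partial>\<nu>) < \<eta> * \<eta> / 2"
    by (auto simp: eventually_sequentially)
  \<comment> \<open>Only late indices have small errors; dropping finitely many keeps the set
    infinite, so that the compactness argument still applies.\<close>
  have "infinite (I - {..<M})" using assms(1) by simp
  with c(2) \<theta> have "\<exists>i\<in>I - {..<M}. \<exists>j\<in>I - {..<M}. i \<noteq> j \<and>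
      c \<le> prob {y \<in> space \<nu>. \<rho> (\<theta> i y) (\<theta> j y) < \<epsilon> / 2}"
    by blast
  then obtain i j where "i \<in> I - {..<M}" "j \<in> I - {..<M}" "i \<noteq> j"
      and low: "c \<le> prob {y \<in> space \<nu>. \<rho> (\<theta> i y) (\<theta> j y) < \<epsilon> / 2}"
    by (elim bexE conjE)
  then have ij: "i \<in> I" "j \<in> I" "i \<ge> M" "j \<ge> M" "i \<noteq> j" by auto
  define f where "f y = \<rho> (\<theta> i y) (\<theta> j y)" for y
  have f [measurable]: "f \<in> borel_measurable \<nu>"
    unfolding f_def by (intro measurable_dist[OF prob_space_axioms X] \<theta>)
  have "prob {y \<in> space \<nu>. \<epsilon> \<le> f y} < \<epsilon>"
  proof (rule F\<eta>[rule_format, OF f])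
    fix \<gamma> assume g: "\<gamma> \<in> F"
    then have g': "\<gamma> \<in> carrier \<Gamma>" using F(2) by blast
    have [measurable]: "\<alpha> \<gamma> \<in> measurable \<nu> \<nu>" by (rule action_measurable[OF g'])
    note int = Bochner_Integration.integrable_add[OF integrable_err[OF g', of i] integrable_err[OF g', of j]]
    have [measurable]: "err n \<gamma> \<in> borel_measurable \<nu>" for n
      using integrable_err[OF g'] by (rule borel_measurable_integrable)
    have "prob {y \<in> space \<nu>. \<eta> \<le> \<bar>f (\<alpha> \<gamma> y) - f y\<bar>} \<le> prob {y \<in> space \<nu>. \<eta> \<le> err i \<gamma> y + err j \<gamma> y}"
    proof (rule finite_measure_mono_AE)
      show "AE y in \<nu>. y \<in> {y \<in> space \<nu>. \<eta> \<le> \<bar>f (\<alpha> \<gamma> y) - f y\<bar>}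
          \<longrightarrow> y \<in> {y \<in> space \<nu>. \<eta> \<le> err i \<gamma> y + err j \<gamma> y}"
        using almost_invariant[OF g', of i j] by eventually_elim (auto simp: f_def)
    qed measurable
    also have "\<dots> \<le> (\<integral>y. err i \<gamma> y + err j \<gamma> y \<partial>\<nu>) / \<eta>"
      using err_nonneg F(3) by (intro integral_Markov_inequality_measure[OF int sets.top]) auto
    also have "(\<integral>y. err i \<gamma> y + err j \<gamma> y \<partial>\<nu>) = (\<integral>y. err i \<gamma> y \<partial>\<nu>) + (\<integral>y. err j \<gamma> y \<partial>\<nu>)"
      using integrable_err[OF g'] by (intro Bochner_Integration.integral_add)
    also have "\<dots> / \<eta> < \<eta>"
      using M[OF ij(3) g] M[OF ij(4) g] F(3) by (simp add: divide_less_eq)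
    finally show "prob {y \<in> space \<nu>. \<eta> \<le> \<bar>f (\<alpha> \<gamma> y) - f y\<bar>} < \<eta>" .
  qed (use low in \<open>simp add: f_def\<close>)
  with ij show ?thesis by (auto simp: f_def)
qed

lemma transfer_subsequence:
  obtains r :: "nat \<Rightarrow> nat" and \<theta>' where "strict_mono r" "\<theta>' \<in> measurable \<nu> (borel_sigma X)"
    "AE y in \<nu>. (\<lambda>k. \<rho> (\<theta> (r k) y) (\<theta>' y)) \<longlonglongrightarrow> 0"
proof -
  \<comment> \<open>The power of one half acts both as distance and, below, as mass: the masses are
    summable for Borel-Cantelli, and off the sets the steps decay geometrically.\<close>
  define A where "A k i j = {y \<in> space \<nu>. (1/2) ^ k \<le> \<rho> (\<theta> i y) (\<theta> j y)}" for k :: nat and i j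
  have A: "A k i j \<in> sets \<nu>" for k i j
  proof -
    have [measurable]: "(\<lambda>y. \<rho> (\<theta> i y) (\<theta> j y)) \<in> borel_measurable \<nu>"
      by (intro measurable_dist[OF prob_space_axioms X] \<theta>)
    show ?thesis unfolding A_def by measurable
  qed
  have sym: "prob (A k j i) < (1/2) ^ k" if "prob (A k i j) < (1/2) ^ k" for k i j
    using that by (simp add: A_def commute)
  have "\<exists>i\<in>I. \<exists>j\<in>I. i \<noteq> j \<and> prob (A k i j) < (1/2) ^ k" if "infinite I" for k I
    using close_pair[OF that, of "(1/2) ^ k"] by (simp add: A_def)
  from infinite_homogeneous_chain[of "\<lambda>k i j. prob (A k i j) < (1/2) ^ k", OF sym this]
  obtain r where r: "strict_mono r" "\<And>k. prob (A k (r k) (r (Suc k))) < (1/2) ^ k" by blast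
  have "AE y in \<nu>. eventually (\<lambda>k. y \<in> space \<nu> - A k (r k) (r (Suc k))) sequentially"
  proof (rule borel_cantelli_AE1[OF A])
    show "summable (\<lambda>k. prob (A k (r k) (r (Suc k))))"
      using r(2) by (intro summable_comparison_test'[OF summable_geometric[of "1/2 :: real"]])
        (auto intro: less_imp_le)
  qed (simp add: less_top[symmetric])
  then have cauchy: "AE y in \<nu>. Metric_space.MCauchy (topspace X) \<rho> (\<lambda>k. \<theta> (r k) y)"
    using AE_space
  proof eventually_elim
    case (elim y)
    have "range (\<lambda>k. \<theta> (r k) y) \<subseteq> carrier K" using \<theta>_closed[OF elim(2)] by auto
    moreover have "eventually (\<lambda>k. \<rho> (\<theta> (r k) y) (\<theta> (r (Suc k)) y) < (1/2) ^ k) sequentially"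
      using elim(1) by eventually_elim (auto simp: A_def)
    ultimately show ?case unfolding topspace by (rule MCauchy_geometric)
  qed
  obtain \<theta>' where "\<theta>' \<in> measurable \<nu> (borel_sigma X)"
      "AE y in \<nu>. (\<lambda>k. \<rho> (\<theta> (r k) y) (\<theta>' y)) \<longlonglongrightarrow> 0"
    by (rule measurable_AE_limit[OF prob_space_axioms X, of "\<lambda>k. \<theta> (r k)", OF \<theta> cauchy])
  with r(1) show thesis by (rule that)
qed

lemma cohomologous_limits: "cohomologous \<Gamma> \<nu> \<alpha> K X u' v'"
proof -
  obtain r :: "nat \<Rightarrow> nat" and \<theta>' where r: "strict_mono r" and \<theta>': "\<theta>' \<in> measurable \<nu> (borel_sigma X)"
      and lim: "AE y in \<nu>. (\<lambda>k. \<rho> (\<theta> (r k) y) (\<theta>' y)) \<longlonglongrightarrow> 0"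
    by (rule transfer_subsequence)
  have \<theta>'_closed: "\<theta>' y \<in> carrier K" if "y \<in> space \<nu>" for y
    using measurable_space[OF \<theta>' that] by (simp add: space_borel_sigma_topspace topspace)
  have "AE y in \<nu>. u' (\<gamma>, y) = \<theta>' (\<alpha> \<gamma> y) \<otimes> v' (\<gamma>, y) \<otimes> inv (\<theta>' y)" if g: "\<gamma> \<in> carrier \<Gamma>" for \<gamma>
  proof -
    have "(\<lambda>k. \<integral>y. norm (err (r k) \<gamma> y) \<partial>\<nu>) \<longlonglongrightarrow> 0"
      using LIMSEQ_subseq_LIMSEQ[OF err_tendsto_0[OF g] r] by (simp add: o_def err_nonneg)
    \<comment> \<open>Convergence in mean yields convergence almost everywhere only along a further
      subsequence. It may depend on \<open>\<gamma>\<close>, because \<open>\<theta>'\<close> is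
      already fixed.\<close>
    then obtain s :: "nat \<Rightarrow> nat" where s: "strict_mono s" "AE y in \<nu>. (\<lambda>k. err (r (s k)) \<gamma> y) \<longlonglongrightarrow> 0"
      using tendsto_L1_AE_subseq[of \<nu> "\<lambda>k. err (r k) \<gamma>", OF integrable_err[OF g]] by blast
    have "AE y in \<nu>. \<forall>n. u n (\<gamma>, y) = \<theta> n (\<alpha> \<gamma> y) \<otimes> v n (\<gamma>, y) \<otimes> inv (\<theta> n y)"
      using coh[OF g] by (simp add: AE_all_countable)
    then show ?thesis
      using s(2) lim action_AE[OF g lim] AE_space
    proof eventually_elim
      case (elim y)
      note y = elim(5)
      have gy: "\<alpha> \<gamma> y \<in> space \<nu>" using measurable_space[OF action_measurable[OF g] y] .
      note closed = \<theta>_closed[OF y] \<theta>_closed[OF gy] \<theta>'_closed[OF y] \<theta>'_closed[OF gy]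
        section_closed[OF u g y] section_closed[OF v g y]
        section_closed[OF u' g y] section_closed[OF v' g y]
      let ?w = "\<theta>' (\<alpha> \<gamma> y) \<otimes> v' (\<gamma>, y) \<otimes> inv (\<theta>' y)"
      \<comment> \<open>This bound on the defect of the limit equation is valid for every
        \<open>n\<close> and tends to 0 along the indices \<open>r (s k)\<close>.\<close>
      let ?b = "\<lambda>n. err n \<gamma> y + \<rho> (\<theta> n (\<alpha> \<gamma> y)) (\<theta>' (\<alpha> \<gamma> y)) + \<rho> (\<theta> n y) (\<theta>' y)"
      have le: "\<rho> (u' (\<gamma>, y)) ?w \<le> ?b n" for n
      proof -
        have "\<rho> (u' (\<gamma>, y)) ?w \<le> \<rho> (u n (\<gamma>, y)) (u' (\<gamma>, y)) + \<rho> (u n (\<gamma>, y)) ?w"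
          using closed by (intro triangle'') auto
        also have "\<rho> (u n (\<gamma>, y)) ?w
            \<le> \<rho> (\<theta> n (\<alpha> \<gamma> y)) (\<theta>' (\<alpha> \<gamma> y)) + \<rho> (v n (\<gamma>, y)) (v' (\<gamma>, y)) + \<rho> (\<theta> n y) (\<theta>' y)"
          unfolding elim(1)[rule_format, of n] using closed by (intro dist_twisted_conj_le)
        finally show ?thesis by (simp add: err_def)
      qed
      have "(\<lambda>k. ?b (r (s k))) \<longlonglongrightarrow> 0 + 0 + 0"
        using elim(2) LIMSEQ_subseq_LIMSEQ[OF elim(3) s(1)] LIMSEQ_subseq_LIMSEQ[OF elim(4) s(1)]
        by (intro tendsto_add) (simp_all add: o_def)
      then have "\<rho> (u' (\<gamma>, y)) ?w \<le> 0 + 0 + 0"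
        by (rule LIMSEQ_le_const) (use le in blast)
      then have "\<rho> (u' (\<gamma>, y)) ?w = 0" using nonneg[of "u' (\<gamma>, y)" ?w] by linarith
      then show ?case using closed zero by simp
    qed
  qed
  with \<theta>' show ?thesis unfolding cohomologous_def by blast
qed

end

section \<open>Closedness of the cohomology relation\<close>

text \<open>Pointwise \<open>\<rho>\<close> is at most
  \<open>\<epsilon> / 2 + B / \<delta> * d\<close>: the first term suffices where \<open>d\<close>
  is below \<open>\<delta>\<close>, and elsewhere the second exceeds the bound \<open>B\<close> of
  \<open>\<rho>\<close>. Integration gives the claim.\<close>

lemma cocycle_dist_tendsto_0_change_metric:
  assumes \<Gamma>: "group \<Gamma>" and \<nu>: "prob_space \<nu>"
    and X: "compact_space X" "compatible_metric X d" "compatible_metric X \<rho>"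
    and small: "\<And>\<epsilon>. \<epsilon> > 0 \<Longrightarrow> \<exists>\<delta>>0. \<forall>x\<in>topspace X. \<forall>y\<in>topspace X. d x y < \<delta> \<longrightarrow> \<rho> x y < \<epsilon>"
    and w: "\<And>n. w n \<in> cocycles \<Gamma> \<nu> \<alpha> K X" "w' \<in> cocycles \<Gamma> \<nu> \<alpha> K X" and g: "\<gamma> \<in> carrier \<Gamma>"
    and lim: "(\<lambda>n. cocycle_dist \<nu> d \<gamma> (w n) w') \<longlonglongrightarrow> 0"
  shows "(\<lambda>n. cocycle_dist \<nu> \<rho> \<gamma> (w n) w') \<longlonglongrightarrow> 0"
proof (rule order_tendstoI)
  fix \<epsilon> :: real assume "\<epsilon> > 0"
  interpret prob_space \<nu> by (rule \<nu>)
  interpret M: Metric_space "topspace X" d using X by (simp add: compatible_metric_def)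
  obtain B where B: "B > 0" "\<And>x y. x \<in> topspace X \<Longrightarrow> y \<in> topspace X \<Longrightarrow> \<rho> x y \<le> B"
    using compact_metric_bounded[OF X(1,3)] by metis
  obtain \<delta> where \<delta>: "\<delta> > 0" "\<forall>x\<in>topspace X. \<forall>y\<in>topspace X. d x y < \<delta> \<longrightarrow> \<rho> x y < \<epsilon> / 2"
    using small[of "\<epsilon> / 2"] \<open>\<epsilon> > 0\<close> by auto
  have le: "\<rho> x y \<le> \<epsilon> / 2 + B / \<delta> * d x y" if xy: "x \<in> topspace X" "y \<in> topspace X" for x y
  proof (cases "d x y < \<delta>")
    case True
    moreover have "0 \<le> B / \<delta> * d x y" using B(1) \<delta>(1) by simp
    ultimately show ?thesis using \<delta>(2) xy by fastforce
  next
    case False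
    then have "B / \<delta> * \<delta> \<le> B / \<delta> * d x y" using B(1) \<delta>(1) by (intro mult_left_mono) auto
    then show ?thesis using B(2)[OF xy] \<delta>(1) \<open>\<epsilon> > 0\<close> by simp
  qed
  have closed: "c (\<gamma>, y) \<in> topspace X" if "c \<in> cocycles \<Gamma> \<nu> \<alpha> K X" "y \<in> space \<nu>" for c y
    using measurable_space[OF section_measurable[OF \<Gamma> \<nu> X(1,2) that(1) g] that(2)]
    by (simp add: space_borel_sigma_topspace)
  have bound: "cocycle_dist \<nu> \<rho> \<gamma> (w n) w' \<le> \<epsilon> / 2 + B / \<delta> * cocycle_dist \<nu> d \<gamma> (w n) w'" for n
  proof -
    note int = cocycle_dist_integrable[OF \<Gamma> \<nu> X(1,2) w(1)[of n] w(2) g]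
    have "cocycle_dist \<nu> \<rho> \<gamma> (w n) w' \<le> (\<integral>y. \<epsilon> / 2 + B / \<delta> * d (w n (\<gamma>, y)) (w' (\<gamma>, y)) \<partial>\<nu>)"
      unfolding cocycle_dist_def
      using cocycle_dist_integrable[OF \<Gamma> \<nu> X(1,3) w(1)[of n] w(2) g] int closed w
      by (intro integral_mono le) auto
    also have "\<dots> = \<epsilon> / 2 + B / \<delta> * cocycle_dist \<nu> d \<gamma> (w n) w'"
      unfolding cocycle_dist_def using int by (simp add: prob_space)
    finally show ?thesis .
  qed
  have "(\<lambda>n. \<epsilon> / 2 + B / \<delta> * cocycle_dist \<nu> d \<gamma> (w n) w') \<longlonglongrightarrow> \<epsilon> / 2 + B / \<delta> * 0"
    by (intro tendsto_intros lim)
  then have "eventually (\<lambda>n. \<epsilon> / 2 + B / \<delta> * cocycle_dist \<nu> d \<gamma> (w n) w' < \<epsilon>) sequentially"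
    by (rule order_tendstoD(2)) (use \<open>\<epsilon> > 0\<close> in simp)
  then show "eventually (\<lambda>n. cocycle_dist \<nu> \<rho> \<gamma> (w n) w' < \<epsilon>) sequentially"
    by eventually_elim (use bound le_less_trans in blast)
next
  fix a :: real assume "a < 0"
  have "0 \<le> cocycle_dist \<nu> \<rho> \<gamma> (w n) w'" for n
    using cocycle_dist_nonneg[OF \<Gamma> \<nu> X(1,3)] .
  with \<open>a < 0\<close> show "eventually (\<lambda>n. a < cocycle_dist \<nu> \<rho> \<gamma> (w n) w') sequentially"
    by (intro always_eventually allI) (rule less_le_trans)
qed

lemma cohomologous_closed:
  fixes \<Gamma> :: "('g, 'm) monoid_scheme" and K :: "('k, 'n) monoid_scheme"
  assumes \<Gamma>: "group \<Gamma>" "countable (carrier \<Gamma>)" and \<nu>: "prob_space \<nu>"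
    and pmp: "pmp_action \<Gamma> \<nu> \<alpha>" and se: "strongly_ergodic \<Gamma> \<nu> \<alpha>"
    and K: "topological_group K X" and X: "compact_space X" "compatible_metric X d"
    and u: "\<And>n. u n \<in> cocycles \<Gamma> \<nu> \<alpha> K X" "u' \<in> cocycles \<Gamma> \<nu> \<alpha> K X"
    and v: "\<And>n. v n \<in> cocycles \<Gamma> \<nu> \<alpha> K X" "v' \<in> cocycles \<Gamma> \<nu> \<alpha> K X"
    and coh: "\<And>n :: nat. cohomologous \<Gamma> \<nu> \<alpha> K X (u n) (v n)"
    and lim: "\<And>\<gamma>. \<gamma> \<in> carrier \<Gamma> \<Longrightarrow> (\<lambda>n. cocycle_dist \<nu> d \<gamma> (u n) u') \<longlonglongrightarrow> 0"
      "\<And>\<gamma>. \<gamma> \<in> carrier \<Gamma> \<Longrightarrow> (\<lambda>n. cocycle_dist \<nu> d \<gamma> (v n) v') \<longlonglongrightarrow> 0"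
  shows "cohomologous \<Gamma> \<nu> \<alpha> K X u' v'"
proof -
  obtain \<rho> where \<rho>: "biinvariant_metric_group K \<rho>" "compatible_metric X \<rho>"
    "\<And>\<epsilon>. \<epsilon> > 0 \<Longrightarrow> \<exists>\<delta>>0. \<forall>x\<in>topspace X. \<forall>y\<in>topspace X. d x y < \<delta> \<longrightarrow> \<rho> x y < \<epsilon>"
    using biinvariant_metric_exists[OF K X] by metis
  have "\<forall>n. \<exists>\<theta>. \<theta> \<in> measurable \<nu> (borel_sigma X) \<and> (\<forall>\<gamma>\<in>carrier \<Gamma>. AE y in \<nu>.
        u n (\<gamma>, y) = \<theta> (\<alpha> \<gamma> y) \<otimes>\<^bsub>K\<^esub> v n (\<gamma>, y) \<otimes>\<^bsub>K\<^esub> inv\<^bsub>K\<^esub> (\<theta> y))"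
    using coh unfolding cohomologous_def by blast
  then obtain \<theta> where \<theta>: "\<And>n. \<theta> n \<in> measurable \<nu> (borel_sigma X)"
    "\<And>n. \<forall>\<gamma>\<in>carrier \<Gamma>. AE y in \<nu>.
        u n (\<gamma>, y) = \<theta> n (\<alpha> \<gamma> y) \<otimes>\<^bsub>K\<^esub> v n (\<gamma>, y) \<otimes>\<^bsub>K\<^esub> inv\<^bsub>K\<^esub> (\<theta> n y)"
    by metis
  have car: "topspace X = carrier K" using K by (simp add: topological_group_def)
  have \<theta>_coh: "AE y in \<nu>. u n (\<gamma>, y) = \<theta> n (\<alpha> \<gamma> y) \<otimes>\<^bsub>K\<^esub> v n (\<gamma>, y) \<otimes>\<^bsub>K\<^esub> inv\<^bsub>K\<^esub> (\<theta> n y)"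
    if "\<gamma> \<in> carrier \<Gamma>" for n \<gamma>
    using \<theta>(2) that by blast
  note change = cocycle_dist_tendsto_0_change_metric[OF \<Gamma>(1) \<nu> X \<rho>(2,3)]
  have lim': "(\<lambda>n. cocycle_dist \<nu> \<rho> \<gamma> (u n) u') \<longlonglongrightarrow> 0" "(\<lambda>n. cocycle_dist \<nu> \<rho> \<gamma> (v n) v') \<longlonglongrightarrow> 0"
    if "\<gamma> \<in> carrier \<Gamma>" for \<gamma>
    using change[OF _ u that lim(1)[OF that]] change[OF _ v that lim(2)[OF that]] by simp_all
  show ?thesis
    by (rule cohomologous_limit.cohomologous_limits[OF cohomologous_limit.intro[OF \<nu> \<rho>(1)
        cohomologous_limit_axioms.intro[OF \<Gamma> pmp se X(1) \<rho>(2) car u v \<theta>(1) \<theta>_coh lim']]])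
qed

section \<open>From sequences of cocycles to closed sets of classes\<close>

lemma openin_cocycle_ball:
  assumes "w \<in> cocycles \<Gamma> \<nu> \<alpha> K X" "\<gamma> \<in> carrier \<Gamma>" "\<epsilon> > 0"
  shows "openin (cocycle_topology \<Gamma> \<nu> \<alpha> K X d)
    {V \<in> Z1 \<Gamma> \<nu> \<alpha> K X. \<exists>v\<in>V. cocycle_dist \<nu> d \<gamma> w v < \<epsilon>}"
  unfolding cocycle_topology_def
  by (rule topology_generated_by_Basis) (use assms in blast)

lemma Z1_nonempty:
  assumes "V \<in> Z1 \<Gamma> \<nu> \<alpha> K X"
  obtains v where "v \<in> V" "v \<in> cocycles \<Gamma> \<nu> \<alpha> K X"
proof -
  obtain v where v: "v \<in> cocycles \<Gamma> \<nu> \<alpha> K X" "V = ae_equal \<Gamma> \<nu> \<alpha> K X `` {v}"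
    using assms unfolding Z1_def by (rule quotientE)
  with equiv_class_self[OF equiv_ae_equal v(1)] show thesis by (intro that) auto
qed

lemma cocycle_dist_lt_representative:
  assumes \<Gamma>: "group \<Gamma>" and \<nu>: "prob_space \<nu>" and X: "compact_space X" "compatible_metric X d"
    and "w \<in> cocycles \<Gamma> \<nu> \<alpha> K X" and V: "V \<in> Z1 \<Gamma> \<nu> \<alpha> K X" "v \<in> V" "v' \<in> V"
    and "\<gamma> \<in> carrier \<Gamma>" "cocycle_dist \<nu> d \<gamma> w v < \<epsilon>"
  shows "cocycle_dist \<nu> d \<gamma> w v' < \<epsilon>"
proof -
  note rep = Z1_rep[OF \<Gamma> \<nu> X V(1)]
  have "cocycle_dist \<nu> d \<gamma> w v' \<le> cocycle_dist \<nu> d \<gamma> w v + cocycle_dist \<nu> d \<gamma> v v'"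
    using cocycle_dist_triangle[OF \<Gamma> \<nu> X] rep(1)[OF V(2)] rep(1)[OF V(3)] assms by blast
  moreover have "cocycle_dist \<nu> d \<gamma> v v' = 0"
    using cocycle_dist_ae_equal[OF \<Gamma> \<nu> X] rep(2)[OF V(2,3)] assms by blast
  ultimately show ?thesis using assms(10) by linarith
qed

text \<open>Countability of the group reduces closure to sequences: a point of the closure gives
  cohomologous pairs in the neighbourhoods \<open>N u' n\<close> and \<open>N v' n\<close>, and
  these converge to \<open>u'\<close> and \<open>v'\<close>, so \<open>cohomologous_closed\<close>
  applies.\<close>

lemma closedin_cohomology_rel:
  fixes \<Gamma> :: "('g, 'm) monoid_scheme" and K :: "('k, 'n) monoid_scheme"
  assumes \<Gamma>: "group \<Gamma>" "countable (carrier \<Gamma>)" and \<nu>: "prob_space \<nu>"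
    and pmp: "pmp_action \<Gamma> \<nu> \<alpha>" and se: "strongly_ergodic \<Gamma> \<nu> \<alpha>"
    and K: "topological_group K X" and X: "compact_space X" "compatible_metric X d"
  shows "closedin (prod_topology (cocycle_topology \<Gamma> \<nu> \<alpha> K X d) (cocycle_topology \<Gamma> \<nu> \<alpha> K X d))
           (cohomology_rel \<Gamma> \<nu> \<alpha> K X)"
proof -
  let ?T = "cocycle_topology \<Gamma> \<nu> \<alpha> K X d" and ?R = "cohomology_rel \<Gamma> \<nu> \<alpha> K X"
    and ?Z = "Z1 \<Gamma> \<nu> \<alpha> K X" and ?C = "cocycles \<Gamma> \<nu> \<alpha> K X"
  have top: "topspace ?T = ?Z" using \<Gamma>(1) by (rule topspace_cocycle_topology)
  define e where "e = from_nat_into (carrier \<Gamma>)"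
  have "carrier \<Gamma> \<noteq> {}" using \<Gamma>(1) by (metis empty_iff group.is_monoid monoid.one_closed)
  then have e: "e i \<in> carrier \<Gamma>" for i unfolding e_def by (rule from_nat_into)
  \<comment> \<open>Only the first \<open>n + 1\<close> group elements are constrained, so the
    intersection is finite and open; each fixed element is constrained from its index on, with
    radius tending to 0.\<close>
  define N where "N w n = (\<Inter>i\<le>n. {V \<in> ?Z. \<exists>v\<in>V. cocycle_dist \<nu> d (e i) w v < inverse (real (Suc n))})"
    for w :: "'g \<times> 'a \<Rightarrow> 'k" and n :: nat
  have openN: "openin ?T (N w n)" if "w \<in> ?C" for w n
    unfolding N_def using that e by (intro openin_INT2) (auto intro: openin_cocycle_ball)
  have memN: "W \<in> N w n" if "W \<in> ?Z" "w \<in> W" for W w n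
  proof -
    have "(w, w) \<in> ae_equal \<Gamma> \<nu> \<alpha> K X" using Z1_rep[OF \<Gamma>(1) \<nu> X that] that by blast
    then have "cocycle_dist \<nu> d (e i) w w = 0" for i using cocycle_dist_ae_equal[OF \<Gamma>(1) \<nu> X] e by blast
    then have "cocycle_dist \<nu> d (e i) w w < inverse (real (Suc n))" for i by simp
    then show ?thesis unfolding N_def using that by blast
  qed
  have lim: "(\<lambda>n. cocycle_dist \<nu> d \<gamma> (w n) w') \<longlonglongrightarrow> 0"
    if "w' \<in> ?C" "\<And>n. W n \<in> N w' n" "\<And>n. w n \<in> W n" "\<gamma> \<in> carrier \<Gamma>" for w' w W \<gamma>
  proof -
    obtain i where i: "\<gamma> = e i" using from_nat_into_surj[OF \<Gamma>(2) \<open>\<gamma> \<in> carrier \<Gamma>\<close>] unfolding e_def by metis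
    have "cocycle_dist \<nu> d \<gamma> (w n) w' \<le> inverse (real (Suc n))" if "n \<ge> i" for n
    proof -
      have "W n \<in> ?Z" "\<exists>v\<in>W n. cocycle_dist \<nu> d \<gamma> w' v < inverse (real (Suc n))"
        using \<open>W n \<in> N w' n\<close> that i by (auto simp: N_def)
      then have "cocycle_dist \<nu> d \<gamma> w' (w n) < inverse (real (Suc n))"
        using cocycle_dist_lt_representative[OF \<Gamma>(1) \<nu> X] \<open>w' \<in> ?C\<close> \<open>w n \<in> W n\<close> \<open>\<gamma> \<in> carrier \<Gamma>\<close>
        by blast
      then show ?thesis by (simp add: cocycle_dist_commute[OF \<Gamma>(1) \<nu> X])
    qed
    moreover have "0 \<le> cocycle_dist \<nu> d \<gamma> (w n) w'" for n by (rule cocycle_dist_nonneg[OF \<Gamma>(1) \<nu> X])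
    ultimately show ?thesis
      by (intro tendsto_sandwich[OF _ _ tendsto_const LIMSEQ_inverse_real_of_nat])
         (auto simp: eventually_sequentially)
  qed
  have "prod_topology ?T ?T closure_of ?R \<subseteq> ?R"
  proof
    fix P assume "P \<in> prod_topology ?T ?T closure_of ?R"
    moreover obtain U V where P: "P = (U, V)" by (rule prod.exhaust)
    ultimately have UV: "U \<in> ?Z" "V \<in> ?Z"
      and meets: "\<And>Q. (U, V) \<in> Q \<Longrightarrow> openin (prod_topology ?T ?T) Q \<Longrightarrow> \<exists>y\<in>?R. y \<in> Q"
      by (auto simp: in_closure_of top)
    obtain u' where u': "u' \<in> U" "u' \<in> ?C" using UV(1) by (rule Z1_nonempty)
    obtain v' where v': "v' \<in> V" "v' \<in> ?C" using UV(2) by (rule Z1_nonempty)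
    have "\<exists>W W' u v. W \<in> N u' n \<and> W' \<in> N v' n \<and> u \<in> W \<and> v \<in> W' \<and> u \<in> ?C \<and> v \<in> ?C
        \<and> cohomologous \<Gamma> \<nu> \<alpha> K X u v" for n
    proof -
      have "\<exists>y\<in>?R. y \<in> N u' n \<times> N v' n"
        using memN UV u' v' openN by (intro meets) (auto simp: openin_prod_Times_iff)
      then obtain W W' u v where *: "W \<in> ?Z" "W' \<in> ?Z" "u \<in> W" "v \<in> W'" "cohomologous \<Gamma> \<nu> \<alpha> K X u v"
          "W \<in> N u' n" "W' \<in> N v' n"
        unfolding cohomology_rel_def by blast
      then have "u \<in> ?C" "v \<in> ?C" using Z1_rep(1)[OF \<Gamma>(1) \<nu> X] by blast+
      with * show ?thesis by blast
    qed
    then obtain W W' u v where *: "\<And>n. W n \<in> N u' n" "\<And>n. W' n \<in> N v' n" "\<And>n. u n \<in> W n" "\<And>n. v n \<in> W' n"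
        "\<And>n. u n \<in> ?C" "\<And>n. v n \<in> ?C" "\<And>n. cohomologous \<Gamma> \<nu> \<alpha> K X (u n) (v n)"
      by metis
    have "cohomologous \<Gamma> \<nu> \<alpha> K X u' v'"
      by (rule cohomologous_closed[OF \<Gamma> \<nu> pmp se K X *(5) u'(2) *(6) v'(2) *(7)
            lim[OF u'(2) *(1,3)] lim[OF v'(2) *(2,4)]])
    then show "P \<in> ?R" using UV u' v' by (auto simp: P cohomology_rel_def)
  qed
  moreover have "?R \<subseteq> topspace (prod_topology ?T ?T)" by (auto simp: top cohomology_rel_def)
  ultimately show ?thesis by (simp add: closure_of_subset_eq[symmetric])
qed

theorem theorem1p4:
  fixes \<Gamma> :: "('g, 'm) monoid_scheme" and \<nu> :: "'y measure" and \<alpha> :: "'g \<Rightarrow> 'y \<Rightarrow> 'y"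
    and K :: "('k, 'n) monoid_scheme" and X :: "'k topology" and d :: "'k \<Rightarrow> 'k \<Rightarrow> real"
  assumes "group \<Gamma>" and "countable (carrier \<Gamma>)"
    and "standard_probability_space \<nu>"
    and "pmp_action \<Gamma> \<nu> \<alpha>" and "strongly_ergodic \<Gamma> \<nu> \<alpha>"
    and "topological_group K X" and "compact_space X" and "metrizable_space X"
    and "compatible_metric X d"
  shows "closedin (prod_topology (cocycle_topology \<Gamma> \<nu> \<alpha> K X d) (cocycle_topology \<Gamma> \<nu> \<alpha> K X d))
           (cohomology_rel \<Gamma> \<nu> \<alpha> K X) \<and>
         (\<forall>C \<in> Z1 \<Gamma> \<nu> \<alpha> K X // cohomology_rel \<Gamma> \<nu> \<alpha> K X.
           closedin (cocycle_topology \<Gamma> \<nu> \<alpha> K X d) C)"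
proof (intro conjI ballI)
  let ?T = "cocycle_topology \<Gamma> \<nu> \<alpha> K X d" and ?R = "cohomology_rel \<Gamma> \<nu> \<alpha> K X"
  have "prob_space \<nu>" using assms(3) by (simp add: standard_probability_space_def)
  then show closed: "closedin (prod_topology ?T ?T) ?R"
    using assms by (intro closedin_cohomology_rel)
  fix C assume "C \<in> Z1 \<Gamma> \<nu> \<alpha> K X // ?R"
  then obtain U where U: "U \<in> Z1 \<Gamma> \<nu> \<alpha> K X" "C = ?R `` {U}" by (rule quotientE)
  have top: "topspace ?T = Z1 \<Gamma> \<nu> \<alpha> K X" using assms(1) by (rule topspace_cocycle_topology)
  \<comment> \<open>The class of \<open>U\<close> is a slice of the relation, hence the preimage of
    a closed set under this embedding.\<close>
  have "continuous_map ?T (prod_topology ?T ?T) (\<lambda>V. (U, V))"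
    using U(1) top by (simp add: continuous_map_pairwise o_def)
  from closedin_continuous_map_preimage[OF this closed]
  have "closedin ?T {V \<in> topspace ?T. (U, V) \<in> ?R}" .
  also have "{V \<in> topspace ?T. (U, V) \<in> ?R} = C"
    by (auto simp: U(2) top cohomology_rel_def)
  finally show "closedin ?T C" .
qed

end
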